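(* Let $a$ be an even positive integer, $R = \mathbb{Z}[x,y,z]/(x^{2a},y^{2a},z^{2a})$ graded by total degree, and $m=3a-2$. Let $\rho$ be the ring automorphism of $R$ with $x\mapsto y\mapsto z\mapsto x$ and $\tau\kappa$ the ring automorphism swapping $y\leftrightarrow z$. Let $R^{C_3}=\{f: \rho(f)=f\}$ and $R^{C_2,-}=\{f : \tau\kappa(f)=-f\}$, and let $W_r$ be the degree-$r$ homogeneous component of $R^{C_3}\cap R^{C_2,-}$ (a free $\mathbb{Z}$-module). Multiplication by $x+y+z$ maps $W_m$ into $W_{m+1}$; call this restricted map $U_m|_{R^{C_3}\cap R^{C_2,-}}$. Then its determinant (computed with respect to any $\mathbb{Z}$-bases, hence defined up to sign) equals, up to sign, the number of cyclically symmetric transpose complementary plane partitions in an $a\times a\times a$ box.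
   Context: A plane partition fitting in an $a\times a\times a$ box is an array $(\pi_{i,j})_{1\le i,j\le a}$ of integers in $\{0,\ldots,a\}$ weakly decreasing along rows and along columns; it corresponds to the set $S_\pi=\{(i,j,k)\in\{1,\ldots,a\}^3 : k\le\pi_{i,j}\}$. It is cyclically symmetric if $S_\pi$ is invariant under $(i,j,k)\mapsto(j,k,i)$, and transpose complementary if $\pi_{j,i}=a-\pi_{a+1-i,\,a+1-j}$ for all $i,j$. A cyclically symmetric transpose complementary plane partition is one with both properties. *)

theory Defs
  imports Main "Jordan_Normal_Form.Determinant"
begin

text \<open>Elements of R = Z[x,y,z]/(x^(2a),y^(2a),z^(2a)) are represented by their
  coefficient functions on exponent triples (i,j,k), i.e. the coefficient of
  x^i y^j z^k; only monomials with i,j,k < 2a may carry non-zero coefficients.\<close>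

type_synonym relt = "nat \<times> nat \<times> nat \<Rightarrow> int"

definition R_elem :: "nat \<Rightarrow> relt \<Rightarrow> bool" where
  "R_elem a f \<longleftrightarrow> (\<forall>i j k. f (i,j,k) \<noteq> 0 \<longrightarrow> i < 2*a \<and> j < 2*a \<and> k < 2*a)"

definition homog :: "nat \<Rightarrow> relt \<Rightarrow> bool" where
  "homog r f \<longleftrightarrow> (\<forall>i j k. f (i,j,k) \<noteq> 0 \<longrightarrow> i + j + k = r)"

text \<open>rho: x -> y -> z -> x sends x^i y^j z^k to x^k y^i z^j.\<close>
definition rho :: "relt \<Rightarrow> relt" where
  "rho f = (\<lambda>(i,j,k). f (j,k,i))"

definition tk :: "relt \<Rightarrow> relt" where
  "tk f = (\<lambda>(i,j,k). f (i,k,j))"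

definition W :: "nat \<Rightarrow> nat \<Rightarrow> relt set" where
  "W a r = {f. R_elem a f \<and> homog r f \<and> rho f = f \<and> tk f = (\<lambda>p. - f p)}"

text \<open>Multiplication by x+y+z in R (monomials leaving the box vanish).\<close>
definition U :: "nat \<Rightarrow> relt \<Rightarrow> relt" where
  "U a f = (\<lambda>(i,j,k). if i < 2*a \<and> j < 2*a \<and> k < 2*a then
       (if 0 < i then f (i-1,j,k) else 0) + (if 0 < j then f (i,j-1,k) else 0)
       + (if 0 < k then f (i,j,k-1) else 0) else 0)"

definition zcomb :: "(nat \<Rightarrow> int) \<Rightarrow> relt list \<Rightarrow> relt" where
  "zcomb c bs = (\<lambda>p. \<Sum>i<length bs. c i * (bs ! i) p)"

definition zbasis :: "relt set \<Rightarrow> relt list \<Rightarrow> bool" where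
  "zbasis V bs \<longleftrightarrow> set bs \<subseteq> V \<and>
     (\<forall>f\<in>V. \<exists>!c. (\<forall>i. length bs \<le> i \<longrightarrow> c i = 0) \<and> f = zcomb c bs)"

definition plane_partition :: "nat \<Rightarrow> (nat \<Rightarrow> nat \<Rightarrow> nat) \<Rightarrow> bool" where
  "plane_partition a \<pi> \<longleftrightarrow>
     (\<forall>i j. \<not> (i \<in> {1..a} \<and> j \<in> {1..a}) \<longrightarrow> \<pi> i j = 0) \<and>
     (\<forall>i j. \<pi> i j \<le> a) \<and>
     (\<forall>i j. i \<in> {1..a} \<and> j \<in> {1..<a} \<longrightarrow> \<pi> i (j+1) \<le> \<pi> i j) \<and>
     (\<forall>i j. i \<in> {1..<a} \<and> j \<in> {1..a} \<longrightarrow> \<pi> (i+1) j \<le> \<pi> i j)"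

definition pp_set :: "nat \<Rightarrow> (nat \<Rightarrow> nat \<Rightarrow> nat) \<Rightarrow> (nat \<times> nat \<times> nat) set" where
  "pp_set a \<pi> = {(i,j,k). i \<in> {1..a} \<and> j \<in> {1..a} \<and> k \<in> {1..a} \<and> k \<le> \<pi> i j}"

definition cyclically_symmetric :: "nat \<Rightarrow> (nat \<Rightarrow> nat \<Rightarrow> nat) \<Rightarrow> bool" where
  "cyclically_symmetric a \<pi> \<longleftrightarrow> (\<lambda>(i,j,k). (j,k,i)) ` pp_set a \<pi> = pp_set a \<pi>"

definition transpose_complementary :: "nat \<Rightarrow> (nat \<Rightarrow> nat \<Rightarrow> nat) \<Rightarrow> bool" where
  "transpose_complementary a \<pi> \<longleftrightarrow>
     (\<forall>i\<in>{1..a}. \<forall>j\<in>{1..a}. int (\<pi> j i) = int a - int (\<pi> (a+1-i) (a+1-j)))"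

definition CSTCPP :: "nat \<Rightarrow> (nat \<Rightarrow> nat \<Rightarrow> nat) set" where
  "CSTCPP a = {\<pi>. plane_partition a \<pi> \<and> cyclically_symmetric a \<pi> \<and> transpose_complementary a \<pi>}"

end

theory Submission
  imports Defs
begin

text \<open>
  Elements of \<open>W a r\<close> are the alternating ones, so the antisymmetrised monomials indexed by triples
  \<open>i > j > k\<close> with sum \<open>r\<close> form a basis. In these bases multiplication by \<open>x + y + z\<close> is the
  bipartite adjacency matrix between such triples of sum \<open>3a - 2\<close> and of sum \<open>3a - 1\<close>; these are
  the unit triangles of a fundamental domain of the hexagon of side \<open>a\<close> under its \<open>S\<^sub>3\<close> symmetry.

  Reading the region row by row (constant exponent of \<open>z\<close>) one sees that all perfect matchings have
  the same number of inversions, so the determinant counts perfect matchings up to sign. Since \<open>a\<close>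
  is even, the triangles on the symmetry axes must be matched among themselves, hence perfect
  matchings of the domain are the same as \<open>S\<^sub>3\<close>-symmetric matchings of the hexagon, that is,
  symmetric lozenge tilings. Such tilings correspond to height functions \<open>g\<close> on \<open>\<int>\<^sup>3\<close> with
  \<open>g (p + (1,1,1)) = g p + 1\<close>, and \<open>{g \<le> 0}\<close> is the set of cubes of the plane partition.
\<close>

section \<open>Reduction to a bipartite adjacency matrix\<close>

text \<open>The determinant is a signed sum over matchings, so a common sign has to come from counts
  that no matching can change: the number of edges leaving a row upwards is a difference of numbers
  of triangles, and each such edge of a given row accounts for the same number of inversions.

  Parity enters on the axes. In a symmetric matching the two mirror-image edges at an axis triangle
  are both present or both absent, so the edge along the axis is forced; for even \<open>a\<close>
  it never leaves the hexagon, because \<open>2*j = a - 1\<close> and \<open>2*j = 3*a - 1\<close>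
  have no solution.

  The exponents of a triangle become coordinate differences, shifted by \<open>a\<close> or
  \<open>a - 1\<close>. Around a triangle the unit steps in the three directions compose to
  \<open>(1,1,1)\<close>, along which the height rises by one, so exactly one of its three edges is
  crossed: this is the matching condition. Exchanging two exponents lifts to
  \<open>(x,y,z) \<mapsto> (a+1-y, a+1-x, a+1-z)\<close>, which reverses \<open>(1,1,1)\<close>;
  hence a mirror symmetry of the tiling shows up as a complementation of the plane
  partition.\<close>

definition strict_triples :: "nat \<Rightarrow> nat \<Rightarrow> (nat \<times> nat \<times> nat) set" where
  "strict_triples a r = {(i,j,k). k < j \<and> j < i \<and> i < 2*a \<and> i + j + k = r}"

definition unit_step :: "nat \<times> nat \<times> nat \<Rightarrow> nat \<times> nat \<times> nat \<Rightarrow> bool" where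
  "unit_step u v \<longleftrightarrow> (case u of (i,j,k) \<Rightarrow> v = (Suc i,j,k) \<or> v = (i,Suc j,k) \<or> v = (i,j,Suc k))"

text \<open>Membership in \<open>extensional\<close> fixes the values off the domain, so that each
  perfect matching is counted exactly once.\<close>

definition matchings :: "nat \<Rightarrow> (nat \<times> nat \<times> nat \<Rightarrow> nat \<times> nat \<times> nat) set" where
  "matchings a = {f \<in> extensional (strict_triples a (3*a-2)).
     bij_betw f (strict_triples a (3*a-2)) (strict_triples a (3*a-1)) \<and>
     (\<forall>u\<in>strict_triples a (3*a-2). unit_step u (f u))}"

lemma finite_strict_triples [simp]: "finite (strict_triples a r)"
proof (rule finite_subset)
  show "strict_triples a r \<subseteq> {..<2*a} \<times> {..<2*a} \<times> {..<2*a}" by (auto simp: strict_triples_def)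
qed simp

text \<open>Central symmetry of the hexagon: complementing every exponent to \<open>2*a-1\<close>
  turns the sum \<open>r\<close> into \<open>6*a-3-r\<close>, which exchanges \<open>3*a-1\<close>
  and \<open>3*a-2\<close>; reversing the triple restores the decreasing order.\<close>

lemma card_strict_triples:
  "0 < a \<Longrightarrow> card (strict_triples a (3*a-1)) = card (strict_triples a (3*a-2))"
  by (rule bij_betw_same_card[of "\<lambda>(i,j,k). (2*a-1-k, 2*a-1-j, 2*a-1-i)"],
      rule bij_betw_byWitness[where f' = "\<lambda>(i,j,k). (2*a-1-k, 2*a-1-j, 2*a-1-i)"])
     (auto simp: strict_triples_def)

section \<open>Alternating elements and their monomial basis\<close>

lemma W_iff:
  "f \<in> W a r \<longleftrightarrow> (\<forall>i j k. f (i,j,k) \<noteq> 0 \<longrightarrow> i < 2*a \<and> j < 2*a \<and> k < 2*a \<and> i + j + k = r) \<and>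
     (\<forall>i j k. f (j,k,i) = f (i,j,k)) \<and> (\<forall>i j k. f (i,k,j) = - f (i,j,k))"
proof -
  have "rho f = f \<longleftrightarrow> (\<forall>i j k. f (j,k,i) = f (i,j,k))"
    unfolding rho_def fun_eq_iff split_paired_All by simp
  moreover have "tk f = (\<lambda>p. - f p) \<longleftrightarrow> (\<forall>i j k. f (i,k,j) = - f (i,j,k))"
    unfolding tk_def fun_eq_iff split_paired_All by simp
  ultimately show ?thesis unfolding W_def R_elem_def homog_def by blast
qed

lemma W_cyc: "f \<in> W a r \<Longrightarrow> f (j,k,i) = f (i,j,k)"
  and W_swap: "f \<in> W a r \<Longrightarrow> f (i,k,j) = - f (i,j,k)"
  unfolding W_iff by blast+

lemma W_swap':
  assumes "f \<in> W a r"
  shows "f (j,i,k) = - f (i,j,k)" "f (k,j,i) = - f (i,j,k)"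
  using W_cyc[OF assms] W_swap[OF assms] by metis+

lemma W_repeated:
  assumes "f \<in> W a r"
  shows "f (i,i,k) = 0" "f (i,k,i) = 0" "f (k,i,i) = 0"
  using W_swap'[OF assms, of i i k] W_swap'[OF assms, of i k i] W_swap[OF assms, of k i i] by auto

text \<open>A triple either repeats an entry, where an alternating element vanishes, or is a
  rearrangement of a strictly decreasing one, whose value it shares up to sign.\<close>

lemma W_zero_if_zero_on_strict:
  assumes f: "f \<in> W a r" and z: "\<And>t. t \<in> strict_triples a r \<Longrightarrow> f t = 0"
  shows "f p = 0"
proof -
  have s: "f (i,j,k) = 0" if "k < j" "j < i" for i j k
  proof (cases "(i,j,k) \<in> strict_triples a r")
    case False
    then show ?thesis using f that unfolding W_iff strict_triples_def by blast
  qed (rule z)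
  obtain i j k where p: "p = (i,j,k)" by (cases p)
  consider "i = j" | "i = k" | "j = k" | "k < j" "j < i" | "j < k" "k < i" | "k < i" "i < j"
    | "i < k" "k < j" | "i < j" "j < k" | "j < i" "i < k" by linarith
  then show ?thesis unfolding p
    using W_repeated[OF f] s W_cyc[OF f, of i j k] W_cyc[OF f, of k i j] W_swap[OF f, of i j k] W_swap'[OF f, of i j k]
    by cases auto
qed

lemma zcomb_in_W:
  assumes "set bs \<subseteq> W a r"
  shows "zcomb c bs \<in> W a r"
proof -
  have b: "bs ! i \<in> W a r" if "i < length bs" for i using assms that by (meson nth_mem subsetD)
  have nz: "\<exists>l<length bs. (bs ! l) p \<noteq> 0" if "zcomb c bs p \<noteq> 0" for p
    using that unfolding zcomb_def by (metis (no_types, lifting) lessThan_iff mult_zero_right sum.neutral)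
  have "i < 2*a \<and> j < 2*a \<and> k < 2*a \<and> i + j + k = r" if z: "zcomb c bs (i,j,k) \<noteq> 0" for i j k
  proof -
    obtain l where l: "l < length bs" "(bs ! l) (i,j,k) \<noteq> 0" using nz[OF z] by blast
    then show ?thesis using b[OF l(1)] unfolding W_iff by blast
  qed
  moreover have "zcomb c bs (j,k,i) = zcomb c bs (i,j,k)" for i j k
    unfolding zcomb_def
  proof (rule sum.cong)
    fix l assume "l \<in> {..<length bs}"
    then have "(bs ! l) (j,k,i) = (bs ! l) (i,j,k)" by (intro W_cyc[OF b]) simp
    then show "c l * (bs ! l) (j,k,i) = c l * (bs ! l) (i,j,k)" by simp
  qed simp
  moreover have "zcomb c bs (i,k,j) = - zcomb c bs (i,j,k)" for i j k
    unfolding zcomb_def sum_negf[symmetric]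
  proof (rule sum.cong)
    fix l assume "l \<in> {..<length bs}"
    then have "(bs ! l) (i,k,j) = - (bs ! l) (i,j,k)" by (intro W_swap[OF b]) simp
    then show "c l * (bs ! l) (i,k,j) = - (c l * (bs ! l) (i,j,k))" by simp
  qed simp
  ultimately show ?thesis unfolding W_iff by blast
qed

lemma W_eqI:
  assumes f: "f \<in> W a r" and g: "g \<in> W a r" and eq: "\<And>t. t \<in> strict_triples a r \<Longrightarrow> f t = g t"
  shows "f = g"
proof -
  have "(\<lambda>p. f p - g p) = zcomb (\<lambda>i. if i = 0 then 1 else - 1) [f,g]"
    by (auto simp: zcomb_def numeral_2_eq_2)
  then have "(\<lambda>p. f p - g p) \<in> W a r" using zcomb_in_W[of "[f,g]" a r] f g by simp
  from W_zero_if_zero_on_strict[OF this] show ?thesis using eq by force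
qed

fun antisym_monomial :: "nat \<times> nat \<times> nat \<Rightarrow> relt" where
  "antisym_monomial (i,j,k) p = of_bool (p = (i,j,k)) + of_bool (p = (j,k,i)) + of_bool (p = (k,i,j))
     - of_bool (p = (i,k,j)) - of_bool (p = (k,j,i)) - of_bool (p = (j,i,k))"

lemma antisym_monomial_in_W: "t \<in> strict_triples a r \<Longrightarrow> antisym_monomial t \<in> W a r"
proof -
  assume t: "t \<in> strict_triples a r"
  obtain i j k where [simp]: "t = (i,j,k)" by (cases t)
  show ?thesis unfolding W_iff
  proof (intro conjI allI)
    fix x y z
    show "antisym_monomial t (x,y,z) \<noteq> 0 \<longrightarrow> x < 2*a \<and> y < 2*a \<and> z < 2*a \<and> x + y + z = r"
      using t by (auto simp: strict_triples_def)
    \<comment> \<open>The symmetries only permute the six indicators: the rotation acts within the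
      positive and within the negative ones, the transposition treated next exchanges the two
      groups.\<close>
    have 1: "(y,z,x) = (i,j,k) \<longleftrightarrow> (x,y,z) = (k,i,j)" "(y,z,x) = (j,k,i) \<longleftrightarrow> (x,y,z) = (i,j,k)"
      "(y,z,x) = (k,i,j) \<longleftrightarrow> (x,y,z) = (j,k,i)" "(y,z,x) = (i,k,j) \<longleftrightarrow> (x,y,z) = (j,i,k)"
      "(y,z,x) = (k,j,i) \<longleftrightarrow> (x,y,z) = (i,k,j)" "(y,z,x) = (j,i,k) \<longleftrightarrow> (x,y,z) = (k,j,i)" by auto
    show "antisym_monomial t (y,z,x) = antisym_monomial t (x,y,z)"
      unfolding \<open>t = (i,j,k)\<close> antisym_monomial.simps 1 by linarith
    have 2: "(x,z,y) = (i,j,k) \<longleftrightarrow> (x,y,z) = (i,k,j)" "(x,z,y) = (j,k,i) \<longleftrightarrow> (x,y,z) = (j,i,k)"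
      "(x,z,y) = (k,i,j) \<longleftrightarrow> (x,y,z) = (k,j,i)" "(x,z,y) = (i,k,j) \<longleftrightarrow> (x,y,z) = (i,j,k)"
      "(x,z,y) = (k,j,i) \<longleftrightarrow> (x,y,z) = (k,i,j)" "(x,z,y) = (j,i,k) \<longleftrightarrow> (x,y,z) = (j,k,i)" by auto
    show "antisym_monomial t (x,z,y) = - antisym_monomial t (x,y,z)"
      unfolding \<open>t = (i,j,k)\<close> antisym_monomial.simps 2 by linarith
  qed
qed

lemma antisym_monomial_strict:
  "t \<in> strict_triples a r \<Longrightarrow> t' \<in> strict_triples a r \<Longrightarrow> antisym_monomial t t' = of_bool (t = t')"
  by (cases t; cases t') (auto simp: strict_triples_def)

text \<open>Each antisymmetrised monomial has exactly one strict triple in its support, so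
  evaluation at \<open>e l\<close> reads off the coefficient with index \<open>l\<close>. This
  yields both existence and uniqueness of the expansion.\<close>

lemma zbasis_antisym_monomials:
  assumes e: "bij_betw e {0..<n} (strict_triples a r)"
  shows "zbasis (W a r) (map (\<lambda>i. antisym_monomial (e i)) [0..<n])"
proof -
  let ?bs = "map (\<lambda>i. antisym_monomial (e i)) [0..<n]"
  have eT: "e i \<in> strict_triples a r" if "i < n" for i using e that by (auto simp: bij_betw_def)
  have esurj: "\<exists>l<n. t = e l" if "t \<in> strict_triples a r" for t
    using e that unfolding bij_betw_def by (metis atLeastLessThan_iff imageE)
  have einj: "e i = e j \<longleftrightarrow> i = j" if "i < n" "j < n" for i j
    using e that by (auto simp: bij_betw_def inj_on_def)
  have "antisym_monomial (e i) \<in> W a r" if "i < n" for i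
    by (rule antisym_monomial_in_W[OF eT[OF that]])
  then have sub: "set ?bs \<subseteq> W a r" by auto
  have ev: "zcomb c ?bs (e l) = c l" if l: "l < n" for c l
  proof -
    have "zcomb c ?bs (e l) = (\<Sum>i<n. if i = l then c i else 0)"
      unfolding zcomb_def using l by (intro sum.cong) (auto simp: antisym_monomial_strict[OF eT eT] einj)
    then show ?thesis using l by simp
  qed
  have "\<exists>!c. (\<forall>i. length ?bs \<le> i \<longrightarrow> c i = 0) \<and> f = zcomb c ?bs" if f: "f \<in> W a r" for f
  proof (rule ex1I)
    let ?c = "\<lambda>i. if i < n then f (e i) else 0"
    show "(\<forall>i. length ?bs \<le> i \<longrightarrow> ?c i = 0) \<and> f = zcomb ?c ?bs"
    proof (intro conjI W_eqI[OF f zcomb_in_W[OF sub]])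
      fix t assume "t \<in> strict_triples a r"
      then obtain l where "l < n" "t = e l" using esurj by blast
      then show "f t = zcomb ?c ?bs t" using ev by simp
    qed auto
    show "c = ?c" if "(\<forall>i. length ?bs \<le> i \<longrightarrow> c i = 0) \<and> f = zcomb c ?bs" for c
      using that ev[of _ c] by auto
  qed
  then show ?thesis unfolding zbasis_def using sub by blast
qed

text \<open>If \<open>m < n\<close>, padding \<open>P\<close> by zero columns and \<open>Q\<close>
  by zero rows gives square matrices with the same product \<open>1\<close>; but \<open>P'\<close>
  has a zero column, so its determinant vanishes.\<close>

lemma right_inverse_dim_le:
  fixes P Q :: "int mat"
  assumes P: "P \<in> carrier_mat n m" and Q: "Q \<in> carrier_mat m n" and PQ: "P * Q = 1\<^sub>m n"
  shows "n \<le> m"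
proof (rule ccontr)
  assume "\<not> n \<le> m"
  then have mn: "m < n" by simp
  define P' where "P' = mat n n (\<lambda>(i,j). if j < m then P $$ (i,j) else 0)"
  define Q' where "Q' = mat n n (\<lambda>(i,j). if i < m then Q $$ (i,j) else 0)"
  have c: "P' \<in> carrier_mat n n" "Q' \<in> carrier_mat n n" by (auto simp: P'_def Q'_def)
  have "P' * Q' = P * Q"
  proof (rule eq_matI)
    fix i j assume "i < dim_row (P * Q)" "j < dim_col (P * Q)"
    then have ij: "i < n" "j < n" using P Q by auto
    have "(P' * Q') $$ (i,j) = (\<Sum>l\<in>{0..<n}. if l < m then P $$ (i,l) * Q $$ (l,j) else 0)"
      using ij c by (auto simp: times_mat_def scalar_prod_def P'_def Q'_def intro!: sum.cong)
    also have "\<dots> = (\<Sum>l\<in>{0..<m}. P $$ (i,l) * Q $$ (l,j))"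
      using mn by (intro sum.mono_neutral_cong_right) auto
    also have "\<dots> = (P * Q) $$ (i,j)"
      using ij P Q by (simp add: times_mat_def scalar_prod_def)
    finally show "(P' * Q') $$ (i,j) = (P * Q) $$ (i,j)" .
  qed (use P Q c in auto)
  then have "det P' * det Q' = 1" using PQ det_mult[OF c] by simp
  moreover have "det P' = 0"
  proof -
    have "(\<Prod>j<n. P' $$ (p j, j)) = 0" if "p permutes {0..<n}" for p
    proof -
      have "p m < n" using permutes_in_image[OF that, of m] mn by simp
      then have "P' $$ (p m, m) = 0" using mn by (simp add: P'_def)
      then show ?thesis using mn by auto
    qed
    then show ?thesis unfolding det_col[OF c(1)] by (intro sum.neutral) auto
  qed
  ultimately show False by simp
qed

text \<open>The matrix of values of a basis at the strictly decreasing triples is the transition matrix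
  to the basis of antisymmetrised monomials.\<close>

lemma zbasis_evaluation_unimodular:
  assumes e: "bij_betw e {0..<n} (strict_triples a r)" and bs: "zbasis (W a r) bs"
  shows "length bs = n \<and> \<bar>det (mat n n (\<lambda>(i,j). (bs ! j) (e i)))\<bar> = 1"
proof -
  define m where "m = length bs"
  have sub: "set bs \<subseteq> W a r" using bs by (simp add: zbasis_def)
  have bW: "bs ! j \<in> W a r" if "j < m" for j using sub that by (auto simp: m_def)
  have eT: "e i \<in> strict_triples a r" if "i < n" for i using e that by (auto simp: bij_betw_def)
  have esurj: "\<exists>l<n. t = e l" if "t \<in> strict_triples a r" for t
    using e that unfolding bij_betw_def by (metis atLeastLessThan_iff imageE)
  have einj: "e i = e j \<longleftrightarrow> i = j" if "i < n" "j < n" for i j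
    using e that by (auto simp: bij_betw_def inj_on_def)
  define P where "P = mat n m (\<lambda>(i,j). (bs ! j) (e i))"
  have "\<exists>c. antisym_monomial (e l) = zcomb c bs" if "l < n" for l
    using bs antisym_monomial_in_W[OF eT[OF that]] unfolding zbasis_def by blast
  then obtain c where c: "\<And>l. l < n \<Longrightarrow> antisym_monomial (e l) = zcomb (c l) bs" by metis
  define Q where "Q = mat m n (\<lambda>(i,l). c l i)"
  have PC: "P \<in> carrier_mat n m" and QC: "Q \<in> carrier_mat m n" by (auto simp: P_def Q_def)
  have PQ: "P * Q = 1\<^sub>m n"
  proof (rule eq_matI)
    fix i l assume "i < dim_row (1\<^sub>m n :: int mat)" "l < dim_col (1\<^sub>m n :: int mat)"
    then have il: "i < n" "l < n" by auto
    have "(P * Q) $$ (i,l) = zcomb (c l) bs (e i)"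
      using il by (simp add: P_def Q_def times_mat_def scalar_prod_def zcomb_def m_def atLeast0LessThan mult.commute)
    also have "\<dots> = 1\<^sub>m n $$ (i,l)"
      using c[OF il(2), symmetric] antisym_monomial_strict[OF eT eT] einj il by auto
    finally show "(P * Q) $$ (i,l) = 1\<^sub>m n $$ (i,l)" .
  qed (auto simp: P_def Q_def)
  \<comment> \<open>At this point \<open>m = n\<close> is still open, so the other product needs its
    own argument: column \<open>j\<close> of \<open>Q * P\<close> and the \<open>j\<close>-th unit
    vector both expand \<open>bs ! j\<close>, the former because \<open>P * Q * P = P\<close>.
    Uniqueness of coefficients identifies them.\<close>
  have QP: "Q * P = 1\<^sub>m m"
  proof (rule eq_matI)
    fix i j assume "i < dim_row (1\<^sub>m m :: int mat)" "j < dim_col (1\<^sub>m m :: int mat)"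
    then have ij: "i < m" "j < m" by auto
    \<comment> \<open>Uniqueness in \<open>zbasis\<close> concerns coefficient sequences that vanish
      from \<open>length bs\<close> on, hence the padding by 0.\<close>
    define d where "d i = (if i < m then (Q * P) $$ (i,j) else 0)" for i
    have d1: "bs ! j = zcomb d bs"
    proof (rule W_eqI[OF bW[OF ij(2)] zcomb_in_W[OF sub]])
      fix t assume "t \<in> strict_triples a r"
      then obtain l where l: "l < n" "t = e l" using esurj by blast
      have "zcomb d bs t = (P * (Q * P)) $$ (l,j)"
        using l ij PC QC by (simp add: zcomb_def d_def P_def scalar_prod_def m_def[symmetric] atLeast0LessThan mult.commute)
      also have "P * (Q * P) = P" using PQ PC QC by (simp add: assoc_mult_mat[symmetric])
      finally show "(bs ! j) t = zcomb d bs t" using l ij by (simp add: P_def)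
    qed
    have d2: "bs ! j = zcomb (\<lambda>i. of_bool (i = j)) bs"
      using ij by (auto simp: zcomb_def m_def of_bool_def if_distrib[of "\<lambda>x. x * _"] cong: if_cong)
    have ex1: "\<exists>!c. (\<forall>i. length bs \<le> i \<longrightarrow> c i = 0) \<and> bs ! j = zcomb c bs"
      using bs bW[OF ij(2)] by (simp add: zbasis_def)
    have z: "\<forall>i. length bs \<le> i \<longrightarrow> d i = 0" "\<forall>i. length bs \<le> i \<longrightarrow> of_bool (i = j) = (0::int)"
      using ij by (auto simp: d_def m_def)
    have "d = (\<lambda>i. of_bool (i = j))"
      using the1_equality[OF ex1, of d] the1_equality[OF ex1, of "\<lambda>i. of_bool (i = j)"] z d1 d2 by argo
    then have "d i = of_bool (i = j)" by simp
    then show "(Q * P) $$ (i,j) = 1\<^sub>m m $$ (i,j)" using ij by (simp add: d_def)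
  qed (auto simp: P_def Q_def)
  have "m = n" using right_inverse_dim_le[OF PC QC PQ] right_inverse_dim_le[OF QC PC QP] by simp
  moreover from this have "det P * det Q = 1" using det_mult[of P n Q] PC QC PQ by simp
  then have "\<bar>det P\<bar> = 1" using abs_zmult_eq_1[of "det P" "det Q"] by simp
  ultimately show ?thesis by (simp add: P_def m_def)
qed

section \<open>Multiplication by x + y + z in coordinates\<close>

lemma U_in_W:
  assumes "f \<in> W a r"
  shows "U a f \<in> W a (Suc r)"
proof -
  have s: "i < 2*a \<and> j < 2*a \<and> k < 2*a \<and> i + j + k = r" if "f (i,j,k) \<noteq> 0" for i j k
    using assms that unfolding W_iff by blast
  show ?thesis unfolding W_iff
  proof (intro conjI allI impI)
    fix i j k
    assume nz: "U a f (i,j,k) \<noteq> 0"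
    then show "i < 2*a" "j < 2*a" "k < 2*a" by (auto simp: U_def split: if_splits)
    have "0 < i \<and> f (i-1,j,k) \<noteq> 0 \<or> 0 < j \<and> f (i,j-1,k) \<noteq> 0 \<or> 0 < k \<and> f (i,j,k-1) \<noteq> 0"
      using nz by (auto simp: U_def split: if_splits)
    then show "i + j + k = Suc r"
      using s[of "i-1" j k] s[of i "j-1" k] s[of i j "k-1"] by auto
  next
    fix i j k
    note e = W_cyc[OF assms, of j k "i-1"] W_cyc[OF assms, of "j-1" k i] W_cyc[OF assms, of j "k-1" i]
    show "U a f (j,k,i) = U a f (i,j,k)" unfolding U_def prod.case e by auto
    note e = W_swap[OF assms, of "i-1" k j] W_swap[OF assms, of i k "j-1"] W_swap[OF assms, of i "k-1" j]
    show "U a f (i,k,j) = - U a f (i,j,k)" unfolding U_def prod.case e by auto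
  qed
qed

lemma of_bool_disj3:
  fixes x :: int
  assumes "\<not> (P \<and> Q)" "\<not> (P \<and> R)" "\<not> (Q \<and> R)"
  shows "of_bool (P \<or> Q \<or> R) * x = of_bool P * x + of_bool Q * x + of_bool R * x"
  using assms by auto

text \<open>Lowering one exponent of a strict triple gives a strict triple or one with two equal
  exponents, where \<open>f\<close> vanishes. Hence the strict neighbours carry the whole
  sum.\<close>

lemma U_eval:
  assumes f: "f \<in> W a r" and v: "v \<in> strict_triples a (Suc r)"
  shows "U a f v = (\<Sum>u\<in>strict_triples a r. of_bool (unit_step u v) * f u)"
proof -
  let ?T = "strict_triples a r"
  obtain i j k where [simp]: "v = (i,j,k)" by (cases v)
  have r: "k < j" "j < i" "i < 2*a" "i + j + k = Suc r" using v by (auto simp: strict_triples_def)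
  have s: "(\<Sum>u\<in>?T. of_bool (P \<and> u = w) * f u) = (if P then f w else 0)"
    if "P \<Longrightarrow> w \<notin> ?T \<Longrightarrow> f w = 0" for P w
  proof (cases "P \<and> w \<in> ?T")
    case True
    then have "(\<Sum>u\<in>?T. of_bool (P \<and> u = w) * f u) = (\<Sum>u\<in>?T. if u = w then f u else 0)"
      by (intro sum.cong) auto
    then show ?thesis using True by simp
  next
    case False
    then have "(\<Sum>u\<in>?T. of_bool (P \<and> u = w) * f u) = 0" by (intro sum.neutral) auto
    then show ?thesis using False that by auto
  qed
  \<comment> \<open>The guards exclude the spurious predecessors that truncated subtraction creates
    at exponent 0; the three alternatives are disjoint because they lower different
    exponents.\<close>
  have "of_bool (unit_step u v) * f u = of_bool (0 < i \<and> u = (i-1,j,k)) * f u +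
      of_bool (0 < j \<and> u = (i,j-1,k)) * f u + of_bool (0 < k \<and> u = (i,j,k-1)) * f u" for u
  proof -
    obtain x y z where u: "u = (x,y,z)" by (cases u)
    have e1: "(i,j,k) = (Suc x,y,z) \<longleftrightarrow> 0 < i \<and> (x,y,z) = (i-1,j,k)" by (cases i) auto
    have e2: "(i,j,k) = (x,Suc y,z) \<longleftrightarrow> 0 < j \<and> (x,y,z) = (i,j-1,k)" by (cases j) auto
    have e3: "(i,j,k) = (x,y,Suc z) \<longleftrightarrow> 0 < k \<and> (x,y,z) = (i,j,k-1)" by (cases k) auto
    have us: "unit_step u v \<longleftrightarrow>
        0 < i \<and> u = (i-1,j,k) \<or> 0 < j \<and> u = (i,j-1,k) \<or> 0 < k \<and> u = (i,j,k-1)"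
      unfolding u unit_step_def \<open>v = (i,j,k)\<close> prod.case e1 e2 e3 by (rule refl)
    have ne: "\<not> ((0 < i \<and> u = (i-1,j,k)) \<and> (0 < j \<and> u = (i,j-1,k)))"
      "\<not> ((0 < i \<and> u = (i-1,j,k)) \<and> (0 < k \<and> u = (i,j,k-1)))"
      "\<not> ((0 < j \<and> u = (i,j-1,k)) \<and> (0 < k \<and> u = (i,j,k-1)))"
      by auto
    show ?thesis unfolding us by (rule of_bool_disj3[OF ne])
  qed
  then have "(\<Sum>u\<in>?T. of_bool (unit_step u v) * f u) =
     (\<Sum>u\<in>?T. of_bool (0 < i \<and> u = (i-1,j,k)) * f u) + (\<Sum>u\<in>?T. of_bool (0 < j \<and> u = (i,j-1,k)) * f u) +
     (\<Sum>u\<in>?T. of_bool (0 < k \<and> u = (i,j,k-1)) * f u)"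
    by (simp only: sum.distrib)
  also have "(\<Sum>u\<in>?T. of_bool (0 < i \<and> u = (i-1,j,k)) * f u) = (if 0 < i then f (i-1,j,k) else 0)"
  proof (rule s)
    assume "0 < i" "(i-1,j,k) \<notin> ?T"
    then have "i - 1 = j" using r by (auto simp: strict_triples_def)
    then show "f (i-1,j,k) = 0" using W_repeated[OF f] by simp
  qed
  also have "(\<Sum>u\<in>?T. of_bool (0 < j \<and> u = (i,j-1,k)) * f u) = (if 0 < j then f (i,j-1,k) else 0)"
  proof (rule s)
    assume "0 < j" "(i,j-1,k) \<notin> ?T"
    then have "j - 1 = k" using r by (auto simp: strict_triples_def)
    then show "f (i,j-1,k) = 0" using W_repeated[OF f] by simp
  qed
  also have "(\<Sum>u\<in>?T. of_bool (0 < k \<and> u = (i,j,k-1)) * f u) = (if 0 < k then f (i,j,k-1) else 0)"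
  proof (rule s)
    assume "0 < k" "(i,j,k-1) \<notin> ?T"
    then show "f (i,j,k-1) = 0" using r by (auto simp: strict_triples_def)
  qed
  finally show ?thesis using r by (simp add: U_def)
qed

section \<open>All matchings have the same sign\<close>

context
  fixes a :: nat and f
  assumes f: "f \<in> matchings a"
begin

lemma matching_mem: "u \<in> strict_triples a (3*a-2) \<Longrightarrow> f u \<in> strict_triples a (3*a-1)"
  using f by (auto simp: matchings_def bij_betw_def)

lemma matching_step: "(i,j,k) \<in> strict_triples a (3*a-2) \<Longrightarrow>
  f (i,j,k) = (Suc i,j,k) \<or> f (i,j,k) = (i,Suc j,k) \<or> f (i,j,k) = (i,j,Suc k)"
  using f unfolding matchings_def unit_step_def by fastforce

end

section \<open>The sign of a permutation as the parity of its inversions\<close>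

definition inversions :: "nat \<Rightarrow> (nat \<Rightarrow> nat) \<Rightarrow> (nat \<times> nat) set" where
  "inversions n p = {(i,j). i < j \<and> j < n \<and> p j < p i}"

text \<open>A product over pairs of positions can be reindexed, which makes multiplicativity
  accessible; for the number of inversions itself only the parity is additive.\<close>

definition inversion_sign :: "nat \<Rightarrow> (nat \<Rightarrow> nat) \<Rightarrow> int" where
  "inversion_sign n p = (\<Prod>(i,j)\<in>{(i,j). i < j \<and> j < n}. sgn (int (p j) - int (p i)))"

lemma finite_index_pairs [simp]: "finite {(i,j). i < j \<and> j < (n::nat)}"
  by (rule finite_subset[of _ "{..<n} \<times> {..<n}"]) auto

lemma inversion_sign_eq:
  assumes "p permutes {0..<n}"
  shows "inversion_sign n p = (- 1) ^ card (inversions n p)"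
proof -
  let ?T = "{(i,j). i < j \<and> j < n}"
  have inj: "p i \<noteq> p j" if "i < j" for i j
    using permutes_inj[OF assms] that by (metis injD less_irrefl)
  have "inversion_sign n p = (\<Prod>x\<in>?T. if x \<in> inversions n p then - 1 else 1)"
    unfolding inversion_sign_def
  proof (rule prod.cong)
    fix x assume "x \<in> ?T"
    then obtain i j where x: "x = (i,j)" "i < j" "j < n" by auto
    then show "(case x of (i,j) \<Rightarrow> sgn (int (p j) - int (p i))) = (if x \<in> inversions n p then - 1 else 1)"
      using inj[of i j] by (auto simp: inversions_def sgn_if)
  qed simp
  also have "\<dots> = (- 1) ^ card (?T \<inter> {x. x \<in> inversions n p})"
    by (simp add: prod.If_cases)
  also have "?T \<inter> {x. x \<in> inversions n p} = inversions n p" by (auto simp: inversions_def)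
  finally show ?thesis .
qed

text \<open>Sending a pair of positions to its sorted image under \<open>p\<close> (the map
  \<open>h p\<close>) permutes the pairs. The factor of \<open>p\<close> at \<open>(i,j)\<close>
  records whether sorting exchanged the images, so its product with the factor of \<open>q\<close>
  at the sorted image is the factor of \<open>q \<circ> p\<close>.\<close>

lemma inversion_sign_compose:
  assumes p: "p permutes {0..<n}" and q: "q permutes {0..<n}"
  shows "inversion_sign n (q \<circ> p) = inversion_sign n q * inversion_sign n p"
proof -
  let ?T = "{(i,j). i < j \<and> j < n}"
  define h where "h p = (\<lambda>(i,j). (min (p i) (p j), max (p i) (p j)))" for p :: "nat \<Rightarrow> nat"
  have hT: "h p ` ?T \<subseteq> ?T" if "p permutes {0..<n}" for p
  proof
    fix x assume "x \<in> h p ` ?T"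
    then obtain i j where ij: "i < j" "j < n" and x: "x = h p (i,j)" by auto
    have "p i \<noteq> p j" "p i < n" "p j < n"
      using ij permutes_inj[OF that] permutes_in_image[OF that, of i] permutes_in_image[OF that, of j]
      by (auto simp: inj_eq)
    then show "x \<in> ?T" unfolding x by (auto simp: h_def)
  qed
  have hh: "h q (h p x) = x" if "x \<in> ?T" "\<And>i. q (p i) = i" for x p q
    using that by (auto simp: h_def min_def max_def)
  have bij: "bij_betw (h p) ?T ?T"
    by (rule bij_betw_byWitness[where f' = "h (Hilbert_Choice.inv p)"])
       (use hT[OF p] hT[OF permutes_inv[OF p]] hh[of _ "Hilbert_Choice.inv p" p] hh[of _ p "Hilbert_Choice.inv p"] permutes_inverses[OF p] in auto)
  have "inversion_sign n q = (\<Prod>x\<in>?T. case h p x of (i,j) \<Rightarrow> sgn (int (q j) - int (q i)))"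
    unfolding inversion_sign_def by (rule prod.reindex_bij_betw[OF bij, symmetric])
  also have "\<dots> * inversion_sign n p = inversion_sign n (q \<circ> p)"
    unfolding inversion_sign_def prod.distrib[symmetric]
  proof (rule prod.cong)
    fix x assume "x \<in> ?T"
    then obtain i j where x: "x = (i,j)" "i < j" by auto
    show "(case h p x of (i,j) \<Rightarrow> sgn (int (q j) - int (q i))) * (case x of (i,j) \<Rightarrow> sgn (int (p j) - int (p i))) =
      (case x of (i,j) \<Rightarrow> sgn (int ((q \<circ> p) j) - int ((q \<circ> p) i)))"
      using permutes_inj[OF p] x by (auto simp: h_def min_def max_def sgn_if inj_eq)
  qed simp
  finally show ?thesis by (rule sym)
qed

text \<open>The inverted pairs are \<open>(x,i)\<close> with \<open>x < i \<le> y\<close> and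
  \<open>(i,y)\<close> with \<open>x < i < y\<close>, altogether the odd number
  \<open>2*(y-x) - 1\<close>.\<close>

lemma inversion_sign_transpose:
  assumes "x < y" "y < n"
  shows "inversion_sign n (transpose x y) = - 1"
proof -
  have "inversions n (transpose x y) = Pair x ` {x<..y} \<union> (\<lambda>i. (i,y)) ` {x<..<y}"
    using assms by (auto simp: inversions_def transpose_def split: if_splits)
  moreover have "card (Pair x ` {x<..y} \<union> (\<lambda>i. (i,y)) ` {x<..<y}) = (y - x) + (y - x - 1)"
    by (subst card_Un_disjoint) (auto simp: card_image inj_on_def)
  moreover have "odd ((y - x) + (y - x - 1))" using assms by presburger
  ultimately show ?thesis
    using assms by (simp add: inversion_sign_eq permutes_swap_id)
qed

lemma sign_eq_inversions:
  assumes "p permutes {0..<n}"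
  shows "sign p = (- 1) ^ card (inversions n p)"
proof -
  from assms finite_atLeastLessThan have "sign p = inversion_sign n p"
  proof (induction rule: permutes_induct)
    case id
    have "inversions n id = {}" by (auto simp: inversions_def)
    then show ?case using inversion_sign_eq[OF permutes_id, of n] by (simp add: id_def)
  next
    case (swap a b p)
    have "inversion_sign n (transpose a b) = - 1"
      using inversion_sign_transpose[of a b n] inversion_sign_transpose[of b a n] swap
      by (cases "a < b") (auto simp: transpose_commute)
    moreover have "permutation p" using swap by (auto simp: permutation_permutes)
    moreover have "transpose a b permutes {0..<n}" using swap by (intro permutes_swap_id) auto
    ultimately show ?case
      unfolding sign_compose[OF permutation_swap_id \<open>permutation p\<close>]
        inversion_sign_compose[OF \<open>p permutes {0..<n}\<close> \<open>transpose a b permutes {0..<n}\<close>]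
      using swap by (simp add: sign_swap_id)
  qed
  then show ?thesis using inversion_sign_eq[OF assms] by simp
qed

text \<open>In the Leibniz expansion exactly the permutations running along edges survive, each
  contributing \<open>s\<close>. If there are none, \<open>s\<close> is unconstrained but both sides
  are 0; otherwise \<open>s\<close> is a sign.\<close>

lemma abs_det_eq_card_permutations:
  fixes A :: "int mat"
  assumes A: "A \<in> carrier_mat n n" and entry: "\<And>i j. i < n \<Longrightarrow> j < n \<Longrightarrow> A $$ (i,j) = of_bool (E j i)"
    and const: "\<And>p. p permutes {0..<n} \<Longrightarrow> \<forall>j<n. E j (p j) \<Longrightarrow> sign p = s"
  shows "\<bar>det A\<bar> = int (card {p. p permutes {0..<n} \<and> (\<forall>j<n. E j (p j))})"
proof -
  let ?P = "{p. p permutes {0..<n}}" and ?G = "{p. p permutes {0..<n} \<and> (\<forall>j<n. E j (p j))}"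
  have "det A = (\<Sum>p\<in>?P. sign p * (\<Prod>j<n. A $$ (p j, j)))"
    using det_col[OF A] by simp
  also have "\<dots> = (\<Sum>p\<in>?P. if \<forall>j<n. E j (p j) then s else 0)"
  proof (rule sum.cong)
    fix p assume "p \<in> ?P"
    then have p: "p permutes {0..<n}" by simp
    have lt: "p j < n" if "j < n" for j using permutes_in_image[OF p, of j] that by simp
    show "sign p * (\<Prod>j<n. A $$ (p j, j)) = (if \<forall>j<n. E j (p j) then s else 0)"
    proof (cases "\<forall>j<n. E j (p j)")
      case True
      then have "(\<Prod>j<n. A $$ (p j, j)) = 1" using lt by (intro prod.neutral) (auto simp: entry)
      then show ?thesis using True const[OF p] by simp
    next
      case False
      then have "(\<Prod>j<n. A $$ (p j, j)) = 0" using lt by (auto simp: entry)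
      then show ?thesis using False by auto
    qed
  qed simp
  also have "\<dots> = (\<Sum>p\<in>?G. s)"
    by (rule sum.mono_neutral_cong_right) (auto simp: finite_permutations)
  also have "\<dots> = int (card ?G) * s" by simp
  finally have d: "det A = int (card ?G) * s" .
  show ?thesis
  proof (cases "?G = {}")
    case True
    show ?thesis unfolding d True by simp
  next
    case False
    then obtain p :: "nat \<Rightarrow> nat" where "sign p = s" using const by auto
    then have "\<bar>s\<bar> = 1" by (auto simp: sign_def split: if_splits)
    then show ?thesis unfolding d by (simp add: abs_mult)
  qed
qed

section \<open>Inversions of a matching, counted row by row\<close>

fun trow :: "nat \<times> nat \<times> nat \<Rightarrow> nat" where "trow (i,j,k) = k"
fun tcol :: "nat \<times> nat \<times> nat \<Rightarrow> nat" where "tcol (i,j,k) = i"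

text \<open>Row-major order. As the degree is fixed, row and first exponent determine a triple, so
  the order is total on each \<open>strict_triples a r\<close>.\<close>

definition before :: "nat \<times> nat \<times> nat \<Rightarrow> nat \<times> nat \<times> nat \<Rightarrow> bool" where
  "before u v \<longleftrightarrow> trow u < trow v \<or> trow u = trow v \<and> tcol u < tcol v"

lemma strict_triples_eqI:
  "u \<in> strict_triples a r \<Longrightarrow> v \<in> strict_triples a r \<Longrightarrow> trow u = trow v \<Longrightarrow> tcol u = tcol v \<Longrightarrow> u = v"
  by (auto simp: strict_triples_def)

text \<open>Each vertical edge of a matching is inverted with exactly as many horizontal edges as
  start in its row, and the number of vertical edges leaving a row is forced by counting.\<close>

lemma card_matching_inversions:
  assumes f: "f \<in> matchings a"
  defines "X \<equiv> strict_triples a (3*a-2)" and "Y \<equiv> strict_triples a (3*a-1)"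
  defines "h \<equiv> \<lambda>k. card {u\<in>X. trow u \<le> k} - card {v\<in>Y. trow v \<le> k}"
  shows "card {(u,u'). u \<in> X \<and> u' \<in> X \<and> before u u' \<and> before (f u') (f u)} =
    (\<Sum>k<2*a. h k * (card {u\<in>X. trow u = k} - h k))"
proof -
  define V where "V = {u\<in>X. trow (f u) = Suc (trow u)}"
  define J where "J u = {u'\<in>X - V. trow u' = trow u \<and> tcol u < tcol u'} \<union>
     {u'\<in>X - V. trow u' = Suc (trow u) \<and> tcol (f u') < tcol u}" for u
  have finX [simp]: "finite X" and finY [simp]: "finite Y" by (simp_all add: X_def Y_def)
  have bij: "bij_betw f X Y" using f by (simp add: matchings_def X_def Y_def)
  have fY: "f u \<in> Y" if "u \<in> X" for u using bij that by (auto simp: bij_betw_def)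
  have inj: "u = u'" if "f u = f u'" "u \<in> X" "u' \<in> X" for u u'
    using bij that by (auto simp: bij_betw_def inj_on_def)
  have vert: "trow (f u) = Suc (trow u)" "tcol (f u) = tcol u" if "u \<in> V" for u
    using that matching_step[OF f, of "fst u" "fst (snd u)" "snd (snd u)"]
    by (cases u; force simp: V_def X_def)+
  have horiz: "trow (f u) = trow u" "tcol u \<le> tcol (f u)" "tcol (f u) \<le> Suc (tcol u)" if "u \<in> X - V" for u
    using that matching_step[OF f, of "fst u" "fst (snd u)" "snd (snd u)"]
    by (cases u; force simp: V_def X_def)+
  \<comment> \<open>Horizontal edges do not cross each other, vertical ones keep the order of their
    endpoints, and a horizontal edge stays before a later vertical one. A vertical edge is overtaken
    by the horizontal edges to its right in its own row and by those of the next row that end to its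
    left.\<close>
  have I: "{(u,u'). u \<in> X \<and> u' \<in> X \<and> before u u' \<and> before (f u') (f u)} = Sigma V J"
  proof (intro subset_antisym subsetI)
    fix z assume "z \<in> {(u,u'). u \<in> X \<and> u' \<in> X \<and> before u u' \<and> before (f u') (f u)}"
    then obtain u u' where z: "z = (u,u')" "u \<in> X" "u' \<in> X" "before u u'" "before (f u') (f u)" by auto
    have b: "trow u < trow u' \<or> trow u = trow u' \<and> tcol u < tcol u'"
      "trow (f u') < trow (f u) \<or> trow (f u') = trow (f u) \<and> tcol (f u') < tcol (f u)"
      using z by (auto simp: before_def)
    have uV: "u \<in> V"
    proof (rule ccontr)
      assume "u \<notin> V"
      then have u: "u \<in> X - V" using z by simp
      show False
      proof (cases "u' \<in> V")
        case True
        then show False using b horiz[OF u] vert[OF True] by linarith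
      next
        case False
        then have u': "u' \<in> X - V" using z by simp
        show False using b horiz[OF u] horiz[OF u'] by linarith
      qed
    qed
    have "u' \<notin> V"
    proof
      assume u': "u' \<in> V"
      show False using b vert[OF u'] vert[OF uV] by linarith
    qed
    then have u': "u' \<in> X - V" using z by simp
    have "trow u' = trow u \<and> tcol u < tcol u' \<or> trow u' = Suc (trow u) \<and> tcol (f u') < tcol u"
      using b vert[OF uV] horiz[OF u'] by linarith
    then show "z \<in> Sigma V J" using z uV u' by (auto simp: J_def)
  next
    fix z assume "z \<in> Sigma V J"
    then obtain u u' where z: "z = (u,u')" and u: "u \<in> V" and u': "u' \<in> X - V"
      and b: "trow u' = trow u \<and> tcol u < tcol u' \<or> trow u' = Suc (trow u) \<and> tcol (f u') < tcol u"
      by (auto simp: J_def)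
    have "before u u'" "before (f u') (f u)"
      unfolding before_def using b vert[OF u] horiz[OF u'] by linarith+
    then show "z \<in> {(u,u'). u \<in> X \<and> u' \<in> X \<and> before u u' \<and> before (f u') (f u)}"
      using z u u' by (simp add: V_def)
  qed
  \<comment> \<open>The triangles of \<open>X\<close> in rows up to \<open>k\<close> are those
    matched into these rows of \<open>Y\<close>, which they exhaust, together with the vertical
    edges leaving row \<open>k\<close>.\<close>
  have cV: "card {u\<in>V. trow u = k} = h k" for k
  proof -
    have "trow u \<le> k \<longleftrightarrow> trow (f u) \<le> k \<or> u \<in> V \<and> trow u = k" if "u \<in> X" for u
      using that vert[of u] horiz[of u] by (cases "u \<in> V") auto
    then have "{u\<in>X. trow u \<le> k} = {u\<in>X. trow (f u) \<le> k} \<union> {u\<in>V. trow u = k}"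
      using V_def by blast
    moreover have "{u\<in>X. trow (f u) \<le> k} \<inter> {u\<in>V. trow u = k} = {}" using vert by auto
    moreover have "card {u\<in>X. trow (f u) \<le> k} = card {v\<in>Y. trow v \<le> k}"
    proof (rule bij_betw_same_card[of f], rule bij_betw_subset[OF bij])
      show "f ` {u\<in>X. trow (f u) \<le> k} = {v\<in>Y. trow v \<le> k}"
        using bij by (auto simp: bij_betw_def)
    qed auto
    ultimately have "card {u\<in>X. trow u \<le> k} = card {v\<in>Y. trow v \<le> k} + card {u\<in>V. trow u = k}"
      by (simp add: card_Un_disjoint V_def)
    then show ?thesis by (simp add: h_def)
  qed
  have cJ: "card (J u) = card {w\<in>X. trow w = trow u} - h (trow u)" if u: "u \<in> V" for u
  proof -
    obtain i j k where uu [simp]: "u = (i,j,k)" by (cases u)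
    have fu: "f u = (i,j,Suc k)"
      using vert[OF u] matching_step[OF f, of i j k] u by (auto simp: V_def X_def)
    have uX: "(i,j,k) \<in> X" using u by (simp add: V_def)
    \<comment> \<open>This makes the strip left of \<open>u\<close> complete in the next row: a
      triangle of row \<open>k\<close> left of \<open>u\<close> has a middle exponent larger than
      \<open>j\<close>, so raising its last exponent keeps it strict.\<close>
    have Suck: "Suc k < j" using fY[OF uX] fu by (simp add: Y_def strict_triples_def)
    define J2 where "J2 = {u'\<in>X - V. trow u' = Suc k \<and> tcol (f u') < i}"
    define L where "L = {w\<in>X - V. trow w = k \<and> tcol w < i}"
    define R where "R = {w\<in>X - V. trow w = k \<and> i < tcol w}"
    \<comment> \<open>A triangle of \<open>Y\<close> in row \<open>k+1\<close> is matched vertically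
      exactly if the triangle of \<open>X\<close> below it lies in \<open>V\<close>. Left of
      \<open>u\<close>, horizontal edges ending in row \<open>k+1\<close> thus correspond to
      horizontal edges starting in row \<open>k\<close>; with the part \<open>R\<close> right of
      \<open>u\<close> they make up all horizontal edges of row \<open>k\<close>.\<close>
    have "bij_betw (\<lambda>u'. case f u' of (i,j,k) \<Rightarrow> (i,j,k-1)) J2 L"
      unfolding bij_betw_def
    proof (intro conjI)
      have r: "trow (f u') = Suc k" if "u' \<in> J2" for u' using that horiz[of u'] by (auto simp: J2_def)
      show "inj_on (\<lambda>u'. case f u' of (i,j,k) \<Rightarrow> (i,j,k-1)) J2"
      proof (rule inj_onI)
        fix u1 u2 assume u12: "u1 \<in> J2" "u2 \<in> J2" and "(case f u1 of (i,j,k) \<Rightarrow> (i,j,k-1)) = (case f u2 of (i,j,k) \<Rightarrow> (i,j,k-1))"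
        then have "f u1 = f u2" using r[OF u12(1)] r[OF u12(2)] by (cases "f u1"; cases "f u2") auto
        then show "u1 = u2" using inj u12 by (auto simp: J2_def)
      qed
      show "(\<lambda>u'. case f u' of (i,j,k) \<Rightarrow> (i,j,k-1)) ` J2 = L"
      proof (intro subset_antisym subsetI)
        fix w assume "w \<in> (\<lambda>u'. case f u' of (i,j,k) \<Rightarrow> (i,j,k-1)) ` J2"
        then obtain u' where u': "u' \<in> J2" "w = (case f u' of (i,j,k) \<Rightarrow> (i,j,k-1))" by blast
        obtain i' j' where fu': "f u' = (i',j',Suc k)" using r[OF u'(1)] by (cases "f u'") auto
        have w: "w = (i',j',k)" using u' fu' by simp
        have u'X: "u' \<in> X" "u' \<notin> V" "i' < i" using u' fu' by (auto simp: J2_def)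
        have "(i',j',Suc k) \<in> Y" using fY[OF u'X(1)] fu' by simp
        then have wX: "w \<in> X" unfolding w by (auto simp: X_def Y_def strict_triples_def)
        moreover have "w \<notin> V"
        proof
          assume wV: "w \<in> V"
          have "f w = (i',j',Suc k)"
            using vert[OF wV] matching_step[OF f, of i' j' k] wX w by (auto simp: X_def)
          then have "w = u'" using inj[of w u'] wX u'X fu' by simp
          then show False using wV u'X by simp
        qed
        ultimately show "w \<in> L" using w u'X by (simp add: L_def)
      next
        fix w assume w: "w \<in> L"
        then obtain i' j' where ww: "w = (i',j',k)" by (cases w) (auto simp: L_def)
        have wX: "w \<in> X" "w \<notin> V" "i' < i" using w ww by (auto simp: L_def)
        have "(i',j',Suc k) \<in> Y"
          using wX uX Suck ww by (auto simp: X_def Y_def strict_triples_def)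
        then obtain u' where u': "u' \<in> X" "f u' = (i',j',Suc k)" using bij by (auto simp: bij_betw_def)
        have "u' \<notin> V"
        proof
          assume u'V: "u' \<in> V"
          obtain i2 j2 k2 where u2: "u' = (i2,j2,k2)" by (cases u')
          have "u' = w" using vert[OF u'V] matching_step[OF f, of i2 j2 k2] u' u2 ww by (auto simp: X_def)
          then show False using u'V wX by simp
        qed
        then have "u' \<in> J2" using u' wX horiz[of u'] by (auto simp: J2_def)
        then show "w \<in> (\<lambda>u'. case f u' of (i,j,k) \<Rightarrow> (i,j,k-1)) ` J2"
          using u' ww by (intro image_eqI[of _ _ u']) auto
      qed
    qed
    then have "card J2 = card L" by (rule bij_betw_same_card)
    moreover have "J u = R \<union> J2" "R \<inter> J2 = {}" by (auto simp: J_def R_def J2_def)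
    then have "card (J u) = card R + card J2" by (simp add: card_Un_disjoint R_def J2_def)
    moreover have "{w\<in>X - V. trow w = k} = R \<union> L"
      using u strict_triples_eqI[OF uX[unfolded X_def]] 
      by (auto simp: R_def L_def X_def) (metis tcol.simps linorder_neqE_nat trow.simps uu)
    then have "card {w\<in>X - V. trow w = k} = card R + card L"
      by (simp add: card_Un_disjoint R_def L_def disjoint_iff)
    moreover have "{w\<in>X - V. trow w = k} = {w\<in>X. trow w = k} - {w\<in>V. trow w = k}" by auto
    then have "card {w\<in>X - V. trow w = k} = card {w\<in>X. trow w = k} - card {w\<in>V. trow w = k}"
      by (simp only: ) (rule card_Diff_subset; auto simp: V_def)
    ultimately show ?thesis using cV[of k] by simp
  qed
  have rowlt: "trow u < 2*a" if "u \<in> V" for u using that by (auto simp: V_def X_def strict_triples_def)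
  have finV: "finite V" by (simp add: V_def)
  have "card (Sigma V J) = (\<Sum>u\<in>V. card (J u))"
    by (rule card_SigmaI) (auto simp: V_def J_def)
  also have "\<dots> = (\<Sum>u\<in>V. card {w\<in>X. trow w = trow u} - h (trow u))" by (rule sum.cong) (auto simp: cJ)
  also have "\<dots> = (\<Sum>k<2*a. \<Sum>u\<in>{u\<in>V. trow u = k}. card {w\<in>X. trow w = trow u} - h (trow u))"
    by (rule sum.group[symmetric]) (use rowlt finV in auto)
  also have "\<dots> = (\<Sum>k<2*a. h k * (card {u\<in>X. trow u = k} - h k))"
    by (rule sum.cong) (simp_all add: cV)
  finally show ?thesis unfolding I .
qed

lemma ordered_enumeration:
  fixes a r :: nat
  defines "T \<equiv> strict_triples a r"
  obtains e where "bij_betw e {0..<card T} T"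
    "\<And>i j. i < card T \<Longrightarrow> j < card T \<Longrightarrow> before (e i) (e j) \<longleftrightarrow> i < j"
proof -
  \<comment> \<open>Columns are smaller than \<open>2*a\<close>, so the numerical order of the keys
    is the row-major order.\<close>
  define key where "key u = 2 * a * trow u + tcol u" for u
  have less: "key u < key v" if "before u v" "u \<in> T" for u v
  proof (cases "trow u < trow v")
    case True
    then have "2 * a * Suc (trow u) \<le> 2 * a * trow v" by (intro mult_le_mono2) simp
    moreover have "tcol u < 2 * a" using that by (auto simp: T_def strict_triples_def)
    ultimately show ?thesis by (simp add: key_def)
  next
    case False
    then show ?thesis using that by (auto simp: before_def key_def)
  qed
  have total: "before u v \<or> u = v \<or> before v u" if "u \<in> T" "v \<in> T" for u v
    using that strict_triples_eqI[of u a r v] unfolding before_def T_def by (meson linorder_neqE_nat)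
  have iff: "before u v \<longleftrightarrow> key u < key v" if "u \<in> T" "v \<in> T" for u v
    using that less[of u v] less[of v u] total[of u v] by auto
  have inj: "inj_on key T" using total less by (metis inj_onI less_irrefl)
  define L where "L = sorted_list_of_set (key ` T)"
  have fin: "finite T" by (simp add: T_def)
  have L: "length L = card T" "set L = key ` T" "sorted_wrt (<) L"
    using fin inj by (auto simp: L_def card_image)
  define e where "e i = the_inv_into T key (L ! i)" for i
  have key_e: "e i \<in> T" "key (e i) = L ! i" if "i < card T" for i
  proof -
    have "L ! i \<in> key ` T" using that L nth_mem by metis
    then show "e i \<in> T" "key (e i) = L ! i"
      unfolding e_def using inj by (auto simp: the_inv_into_f_f)
  qed
  have ord: "before (e i) (e j) \<longleftrightarrow> i < j" if "i < card T" "j < card T" for i j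
    using that L sorted_wrt_nth_less[OF L(3), of i j] sorted_wrt_nth_less[OF L(3), of j i] key_e
    by (metis iff less_irrefl less_trans linorder_neqE_nat)
  have "inj_on e {0..<card T}"
  proof (rule inj_onI)
    fix i j assume "i \<in> {0..<card T}" "j \<in> {0..<card T}" "e i = e j"
    then show "i = j" using ord[of i j] ord[of j i] ord[of i i] by (cases i j rule: linorder_cases) auto
  qed
  moreover have "e ` {0..<card T} = T"
    by (rule card_subset_eq) (use fin key_e calculation in \<open>auto simp: card_image\<close>)
  ultimately show thesis using that ord by (simp add: bij_betw_def)
qed

text \<open>Through the ordered enumerations, permutations along edges are matchings, and their
  inversions are the pairs counted in \<open>card_matching_inversions\<close>. The formula for that
  count does not mention the matching, so all signs agree.\<close>

lemma abs_det_adjacency: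
  fixes a :: nat and A :: "int mat"
  defines "X \<equiv> strict_triples a (3*a-2)" and "Y \<equiv> strict_triples a (3*a-1)"
  assumes ex: "bij_betw ex {0..<n} X" and ordx: "\<And>i j. i < n \<Longrightarrow> j < n \<Longrightarrow> before (ex i) (ex j) \<longleftrightarrow> i < j"
    and ey: "bij_betw ey {0..<n} Y" and ordy: "\<And>i j. i < n \<Longrightarrow> j < n \<Longrightarrow> before (ey i) (ey j) \<longleftrightarrow> i < j"
    and A: "A \<in> carrier_mat n n"
    and entry: "\<And>i j. i < n \<Longrightarrow> j < n \<Longrightarrow> A $$ (i,j) = of_bool (unit_step (ex j) (ey i))"
  shows "\<bar>det A\<bar> = int (card (matchings a))"
proof -
  define G where "G = {p. p permutes {0..<n} \<and> (\<forall>j<n. unit_step (ex j) (ey (p j)))}"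
  define x where "x = the_inv_into {0..<n} ex"
  define y where "y = the_inv_into {0..<n} ey"
  have x: "x u < n" "ex (x u) = u" if "u \<in> X" for u
    using ex that f_the_inv_into_f_bij_betw[OF ex] the_inv_into_into[of ex "{0..<n}" u "{0..<n}"]
    by (auto simp: x_def bij_betw_def)
  have x': "x (ex j) = j" "ex j \<in> X" if "j < n" for j
    using ex that by (auto simp: x_def bij_betw_def the_inv_into_f_f)
  have y: "y v < n" "ey (y v) = v" if "v \<in> Y" for v
    using ey that f_the_inv_into_f_bij_betw[OF ey] the_inv_into_into[of ey "{0..<n}" v "{0..<n}"]
    by (auto simp: y_def bij_betw_def)
  have y': "y (ey j) = j" "ey j \<in> Y" if "j < n" for j
    using ey that by (auto simp: y_def bij_betw_def the_inv_into_f_f)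
  define \<Phi> where "\<Phi> p = restrict (\<lambda>u. ey (p (x u))) X" for p
  have \<Phi>_ex: "\<Phi> p (ex j) = ey (p j)" if "j < n" for p j
    using that x' by (simp add: \<Phi>_def)
  have plt: "p j < n" if "p permutes {0..<n}" "j < n" for p j
    using permutes_in_image[OF that(1), of j] that by simp
  have \<Phi>_m: "\<Phi> p \<in> matchings a" if p: "p \<in> G" for p
  proof -
    have pp: "p permutes {0..<n}" using p by (simp add: G_def)
    have "bij_betw (ey \<circ> p \<circ> x) X Y"
    proof (intro bij_betw_trans)
      show "bij_betw x X {0..<n}" unfolding x_def by (rule bij_betw_the_inv_into[OF ex])
      show "bij_betw p {0..<n} {0..<n}" by (rule permutes_imp_bij[OF pp])
      show "bij_betw ey {0..<n} Y" by (rule ey)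
    qed
    then have "bij_betw (\<Phi> p) X Y"
      by (subst bij_betw_cong[of _ _ "ey \<circ> p \<circ> x"]) (simp_all add: \<Phi>_def)
    moreover have "unit_step u (\<Phi> p u)" if u: "u \<in> X" for u
      using p x[OF u] u by (auto simp: G_def \<Phi>_def)
    ultimately show ?thesis by (auto simp: matchings_def \<Phi>_def X_def Y_def)
  qed
  have "bij_betw \<Phi> G (matchings a)"
    unfolding bij_betw_def
  proof (intro conjI subset_antisym subsetI)
    show "inj_on \<Phi> G"
    proof (rule inj_onI, rule ext)
      fix p q j assume pq: "p \<in> G" "q \<in> G" "\<Phi> p = \<Phi> q"
      show "p j = q j"
      proof (cases "j < n")
        case True
        have "ey (p j) = ey (q j)" using \<Phi>_ex[OF True] pq(3) by metis
        then show ?thesis using y'(1) plt True pq by (metis (mono_tags, lifting) G_def mem_Collect_eq)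
      next
        case False
        then show ?thesis using pq permutes_not_in[of p "{0..<n}" j] permutes_not_in[of q "{0..<n}" j] by (simp add: G_def)
      qed
    qed
    show "f \<in> matchings a" if "f \<in> \<Phi> ` G" for f using that \<Phi>_m by blast
    fix f assume f: "f \<in> matchings a"
    have bf: "bij_betw f X Y" and ef: "f \<in> extensional X" and sf: "\<And>u. u \<in> X \<Longrightarrow> unit_step u (f u)"
      using f by (auto simp: matchings_def X_def Y_def)
    have fY: "f u \<in> Y" if "u \<in> X" for u using bf that by (auto simp: bij_betw_def)
    define p where "p j = (if j \<in> {0..<n} then (y \<circ> f \<circ> ex) j else j)" for j
    have "bij_betw (y \<circ> f \<circ> ex) {0..<n} {0..<n}"
    proof (intro bij_betw_trans)
      show "bij_betw y Y {0..<n}" unfolding y_def by (rule bij_betw_the_inv_into[OF ey])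
    qed (fact ex bf)+
    then have "bij_betw p {0..<n} {0..<n}"
      by (subst bij_betw_cong[of _ _ "y \<circ> f \<circ> ex"]) (auto simp: p_def)
    then have "p permutes {0..<n}" by (rule bij_imp_permutes) (simp add: p_def)
    moreover have eyp: "ey (p j) = f (ex j)" if "j < n" for j
      using that y fY x' by (simp add: p_def)
    ultimately have "p \<in> G" using sf x' by (auto simp: G_def)
    moreover have "\<Phi> p = f"
    proof (rule extensionalityI[OF _ ef])
      show "\<Phi> p u = f u" if "u \<in> X" for u using that eyp x by (simp add: \<Phi>_def)
    qed (simp add: \<Phi>_def)
    ultimately show "f \<in> \<Phi> ` G" by blast
  qed
  then have card: "card G = card (matchings a)" by (rule bij_betw_same_card)
  define N where "N = (\<Sum>k<2*a. (card {u\<in>X. trow u \<le> k} - card {v\<in>Y. trow v \<le> k}) *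
     (card {u\<in>X. trow u = k} - (card {u\<in>X. trow u \<le> k} - card {v\<in>Y. trow v \<le> k})))"
  have "sign p = (- 1) ^ N" if pp: "p permutes {0..<n}" and pG: "\<forall>j<n. unit_step (ex j) (ey (p j))" for p
  proof -
    have p: "p \<in> G" using pp pG by (simp add: G_def)
    let ?f = "\<Phi> p"
    let ?I = "{(u,u'). u \<in> X \<and> u' \<in> X \<and> before u u' \<and> before (?f u') (?f u)}"
    have "bij_betw (\<lambda>(i,j). (ex i, ex j)) (inversions n p) ?I"
    proof (rule bij_betw_byWitness[where f' = "\<lambda>(u,u'). (x u, x u')"])
      show "\<forall>z\<in>inversions n p. (case case z of (i,j) \<Rightarrow> (ex i, ex j) of (u,u') \<Rightarrow> (x u, x u')) = z"
        using x' by (auto simp: inversions_def)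
      show "\<forall>z\<in>?I. (case case z of (u,u') \<Rightarrow> (x u, x u') of (i,j) \<Rightarrow> (ex i, ex j)) = z"
        using x by auto
      have *: "before (?f (ex j)) (?f (ex i)) \<longleftrightarrow> p j < p i" if "i < n" "j < n" for i j
        using that \<Phi>_ex ordy plt[OF pp] by simp
      show "(\<lambda>(i,j). (ex i, ex j)) ` inversions n p \<subseteq> ?I"
        using x' ordx * by (auto simp: inversions_def)
      have "(x u, x u') \<in> inversions n p" if "(u,u') \<in> ?I" for u u'
        using that x[of u] x[of u'] ordx[of "x u" "x u'"] *[of "x u" "x u'"] by (auto simp: inversions_def)
      then show "(\<lambda>(u,u'). (x u, x u')) ` ?I \<subseteq> inversions n p" by auto
    qed
    then have "card (inversions n p) = card ?I" by (rule bij_betw_same_card)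
    also have "\<dots> = N"
      unfolding N_def X_def Y_def by (rule card_matching_inversions[OF \<Phi>_m[OF p]])
    finally show ?thesis using sign_eq_inversions[OF pp] by simp
  qed
  then have "\<bar>det A\<bar> = int (card G)"
    unfolding G_def by (intro abs_det_eq_card_permutations[OF A entry]) auto
  then show ?thesis using card by simp
qed

section \<open>Height functions on the hexagon\<close>

text \<open>The points whose projection along \<open>(1,1,1)\<close> lies in the projection of the
  box with coordinates from 0 to \<open>a\<close>.\<close>

definition hexpt :: "int \<Rightarrow> int \<Rightarrow> int \<Rightarrow> int \<Rightarrow> bool" where
  "hexpt a x y z \<longleftrightarrow> \<bar>x - y\<bar> \<le> a \<and> \<bar>y - z\<bar> \<le> a \<and> \<bar>z - x\<bar> \<le> a"

text \<open>\<open>C i j k\<close> means that the triangle \<open>(i,j,k)\<close> is joined to \<open>(i,j,k+1)\<close>. By symmetry the edges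
  from \<open>(i,j,k)\<close> in the other two directions are \<open>C j k i\<close> and \<open>C i k j\<close>.\<close>

definition sym_matching :: "int \<Rightarrow> (int \<Rightarrow> int \<Rightarrow> int \<Rightarrow> bool) \<Rightarrow> bool" where
  "sym_matching a C \<longleftrightarrow>
     (\<forall>i j k. C i j k \<longrightarrow> i + j + k = 3*a - 2 \<and> i \<in> {0..<2*a} \<and> j \<in> {0..<2*a} \<and> k \<in> {0..<2*a-1}) \<and>
     (\<forall>i j k. C i j k \<longrightarrow> C j i k) \<and>
     (\<forall>i\<in>{0..<2*a}. \<forall>j\<in>{0..<2*a}. \<forall>k\<in>{0..<2*a}. i + j + k = 3*a - 2 \<longrightarrow>
        of_bool (C j k i) + of_bool (C i k j) + of_bool (C i j k) = (1::int)) \<and>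
     (\<forall>i\<in>{0..<2*a}. \<forall>j\<in>{0..<2*a}. \<forall>k\<in>{0..<2*a}. i + j + k = 3*a - 1 \<longrightarrow>
        of_bool (C j k (i-1)) + of_bool (C i k (j-1)) + of_bool (C i j (k-1)) = (1::int))"

text \<open>The lines in direction \<open>(1,1,1)\<close> through the points with \<open>hexpt\<close> are the lattice points of the
  hexagon; a step from \<open>(x,y,z)\<close> to \<open>(x,y,z+1)\<close> crosses the lozenge of the edge
  \<open>C (a+z-y) (a-1+x-z) (a-1+y-x)\<close>. The third and fourth clauses express that the plane partition
  \<open>{g \<le> 0}\<close> is cyclically symmetric and transpose complementary, the last one that it contains
  the walls of the box.\<close>

definition height :: "int \<Rightarrow> (int \<Rightarrow> int \<Rightarrow> int \<Rightarrow> bool) \<Rightarrow> (int \<Rightarrow> int \<Rightarrow> int \<Rightarrow> int) \<Rightarrow> bool" where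
  "height a C g \<longleftrightarrow>
     (\<forall>x y z. g (x+1) (y+1) (z+1) = g x y z + 1) \<and>
     (\<forall>x y z. hexpt a x y z \<longrightarrow> hexpt a x y (z+1) \<longrightarrow>
        g x y (z+1) = g x y z + of_bool (C (a+z-y) (a-1+x-z) (a-1+y-x))) \<and>
     (\<forall>x y z. hexpt a x y z \<longrightarrow> g y z x = g x y z) \<and>
     (\<forall>x y z. hexpt a x y z \<longrightarrow> g (a+1-y) (a+1-x) (a+1-z) = 1 - g x y z) \<and>
     (\<forall>x y z. hexpt a x y z \<longrightarrow> min x (min y z) \<le> 0 \<longrightarrow> max x (max y z) \<le> a \<longrightarrow> g x y z \<le> 0)"

lemma diag_shift:
  fixes g :: "int \<Rightarrow> int \<Rightarrow> int \<Rightarrow> int"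
  assumes "\<And>x y z. g (x+1) (y+1) (z+1) = g x y z + c"
  shows "g (x+t) (y+t) (z+t) = g x y z + t * c"
proof (induction t rule: int_induct[of _ 0])
  case base
  then show ?case by simp
next
  case (step1 t)
  have "g (x+(t+1)) (y+(t+1)) (z+(t+1)) = g (x+t+1) (y+t+1) (z+t+1)"
    by (simp add: algebra_simps)
  also have "\<dots> = g (x+t) (y+t) (z+t) + c" by (rule assms)
  finally show ?case using step1 by (simp add: algebra_simps)
next
  case (step2 t)
  have "g (x+t) (y+t) (z+t) = g (x+(t-1)+1) (y+(t-1)+1) (z+(t-1)+1)"
    by (simp add: algebra_simps)
  also have "\<dots> = g (x+(t-1)) (y+(t-1)) (z+(t-1)) + c" by (rule assms)
  finally show ?case using step2 by (simp add: algebra_simps)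
qed

lemma int_interval_constant:
  fixes f :: "int \<Rightarrow> int"
  assumes "m \<le> n" and "\<And>t. m \<le> t \<Longrightarrow> t < n \<Longrightarrow> f (t+1) = f t"
  shows "f n = f m"
  using assms
proof (induction n rule: int_ge_induct)
  case (step n)
  then show ?case by force
qed simp

lemma int_interval_mono:
  fixes f :: "int \<Rightarrow> int"
  assumes "m \<le> n" and "\<And>t. m \<le> t \<Longrightarrow> t < n \<Longrightarrow> f t \<le> f (t+1)"
  shows "f m \<le> f n"
  using assms
proof (induction n rule: int_ge_induct)
  case (step n)
  then show ?case by force
qed simp

text \<open>The hexagon is connected by an explicit path: lower the coordinates one after another to
  their minimum \<open>m\<close>, which keeps all of them between \<open>m\<close> and
  \<open>m + a\<close>, then slide along the diagonal to the origin.\<close>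

lemma hexpt_constant:
  fixes F :: "int \<Rightarrow> int \<Rightarrow> int \<Rightarrow> int"
  assumes diag: "\<And>x y z. F (x+1) (y+1) (z+1) = F x y z"
    and s1: "\<And>x y z. hexpt a x y z \<Longrightarrow> hexpt a (x+1) y z \<Longrightarrow> F (x+1) y z = F x y z"
    and s2: "\<And>x y z. hexpt a x y z \<Longrightarrow> hexpt a x (y+1) z \<Longrightarrow> F x (y+1) z = F x y z"
    and s3: "\<And>x y z. hexpt a x y z \<Longrightarrow> hexpt a x y (z+1) \<Longrightarrow> F x y (z+1) = F x y z"
    and h: "hexpt a x y z"
  shows "F x y z = F 0 0 0"
proof -
  define m where "m = min x (min y z)"
  have m: "m \<le> x" "m \<le> y" "m \<le> z" unfolding m_def by auto
  have b: "x - m \<le> a" "y - m \<le> a" "z - m \<le> a" using h unfolding m_def hexpt_def by auto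
  have "F x y z = F m y z"
    by (rule int_interval_constant[where f="\<lambda>t. F t y z"])
       (use m b h in \<open>auto intro!: s1 simp: hexpt_def\<close>)
  also have "\<dots> = F m m z"
    by (rule int_interval_constant[where f="\<lambda>t. F m t z"])
       (use m b h in \<open>auto intro!: s2 simp: hexpt_def\<close>)
  also have "\<dots> = F m m m"
    by (rule int_interval_constant[where f="\<lambda>t. F m m t"])
       (use m b h in \<open>auto intro!: s3 simp: hexpt_def\<close>)
  also have "\<dots> = F 0 0 0"
    using diag_shift[of F 0 0 m 0 0] diag by simp
  finally show ?thesis .
qed

context
  fixes a :: int and C g
  assumes height: "height a C g"
begin

lemma height_diag: "g (x+t) (y+t) (z+t) = g x y z + t"
  using height diag_shift[of g 1] by (simp add: height_def)

lemma height_cyc: "hexpt a x y z \<Longrightarrow> g y z x = g x y z"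
  using height unfolding height_def by blast

lemma height_flip: "hexpt a x y z \<Longrightarrow> g (a+1-y) (a+1-x) (a+1-z) = 1 - g x y z"
  using height unfolding height_def by blast

lemma height_low: "hexpt a x y z \<Longrightarrow> min x (min y z) \<le> 0 \<Longrightarrow> max x (max y z) \<le> a \<Longrightarrow> g x y z \<le> 0"
  using height unfolding height_def by blast

text \<open>The flip turns a coordinate above \<open>a\<close> into a nonpositive one, and
  \<open>hexpt\<close> keeps the remaining flipped coordinates at most \<open>a\<close>, so
  \<open>height_low\<close> applies to the image.\<close>

lemma height_high:
  assumes "hexpt a x y z" "max x (max y z) > a"
  shows "1 \<le> g x y z"
proof -
  have "g (a+1-y) (a+1-x) (a+1-z) \<le> 0"
    by (rule height_low) (use assms in \<open>auto simp: hexpt_def min_def max_def split: if_splits\<close>)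
  then show ?thesis using height_flip[OF assms(1)] by simp
qed

lemma height_step3:
  "hexpt a x y z \<Longrightarrow> hexpt a x y (z+1) \<Longrightarrow>
     g x y (z+1) = g x y z + of_bool (C (a+z-y) (a-1+x-z) (a-1+y-x))"
  using height unfolding height_def by blast

lemma height_step1:
  assumes "hexpt a x y z" "hexpt a (x+1) y z"
  shows "g (x+1) y z = g x y z + of_bool (C (a+x-z) (a-1+y-x) (a-1+z-y))"
  using height_step3[of y z x] height_cyc[OF assms(1)] height_cyc[OF assms(2)] assms
  by (auto simp: hexpt_def)

lemma height_step2:
  assumes "hexpt a x y z" "hexpt a x (y+1) z"
  shows "g x (y+1) z = g x y z + of_bool (C (a+y-x) (a-1+z-y) (a-1+x-z))"
  using height_step1[of y z x] height_cyc[OF assms(1)] height_cyc[OF assms(2)] assms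
  by (auto simp: hexpt_def)

lemma height_mono:
  assumes "hexpt a x y z"
  shows "hexpt a (x+1) y z \<Longrightarrow> g x y z \<le> g (x+1) y z"
    "hexpt a x (y+1) z \<Longrightarrow> g x y z \<le> g x (y+1) z"
    "hexpt a x y (z+1) \<Longrightarrow> g x y z \<le> g x y (z+1)"
  using height_step1[OF assms] height_step2[OF assms] height_step3[OF assms] by simp_all

lemma height_step1':
  "hexpt a x y z \<Longrightarrow> hexpt a (x+1) y z \<Longrightarrow> i = a+x-z \<Longrightarrow> j = a-1+y-x \<Longrightarrow> k = a-1+z-y \<Longrightarrow>
     g (x+1) y z = g x y z + of_bool (C i j k)"
  using height_step1 by simp

lemma height_step2':
  "hexpt a x y z \<Longrightarrow> hexpt a x (y+1) z \<Longrightarrow> i = a+y-x \<Longrightarrow> j = a-1+z-y \<Longrightarrow> k = a-1+x-z \<Longrightarrow>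
     g x (y+1) z = g x y z + of_bool (C i j k)"
  using height_step2 by simp

lemma height_step3':
  "hexpt a x y z \<Longrightarrow> hexpt a x y (z+1) \<Longrightarrow> i = a+z-y \<Longrightarrow> j = a-1+x-z \<Longrightarrow> k = a-1+y-x \<Longrightarrow>
     g x y (z+1) = g x y z + of_bool (C i j k)"
  using height_step3 by simp

end

text \<open>The steps prescribed by \<open>C\<close> determine a height function up to an additive
  constant. It is pinned at the corner \<open>(0,a,0)\<close>: the walls give height at most 0
  there, and complementation, the diagonal rule and the wall point \<open>(0,a,a)\<close> give at
  least 0.\<close>

lemma height_unique:
  assumes g: "height a C g" and g': "height a C g'" and h: "hexpt a x y z" and a: "0 \<le> a"
  shows "g x y z = g' x y z"
proof -
  define F where "F x y z = g x y z - g' x y z" for x y z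
  have *: "F x y z = F 0 0 0" if "hexpt a x y z" for x y z
    apply (rule hexpt_constant[OF _ _ _ _ that])
    subgoal using height_diag[OF g, of _ 1] height_diag[OF g', of _ 1] by (simp add: F_def)
    subgoal using height_step1[OF g] height_step1[OF g'] by (simp add: F_def)
    subgoal using height_step2[OF g] height_step2[OF g'] by (simp add: F_def)
    subgoal using height_step3[OF g] height_step3[OF g'] by (simp add: F_def)
    done
  have corner: "f 0 a 0 = 0" if f: "height a C f" for f
  proof -
    have "f 0 a 0 \<le> 0" "f 0 a a \<le> 0"
      using a by (auto intro!: height_low[OF f] simp: hexpt_def)
    moreover have "f 1 (a+1) (a+1) = 1 - f 0 a 0"
      using height_flip[OF f, of 0 a 0] a by (simp add: hexpt_def)
    moreover have "f 1 (a+1) (a+1) = f 0 a a + 1"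
      using height_diag[OF f, of 0 1 a a] by simp
    ultimately show ?thesis by linarith
  qed
  have "F 0 a 0 = 0" using corner[OF g] corner[OF g'] by (simp add: F_def)
  then have "F x y z = 0"
    using *[OF h] *[of 0 a 0] a by (simp add: hexpt_def)
  then show ?thesis by (simp add: F_def)
qed

text \<open>Three unit steps in different directions raise the height by 1, so exactly one of them
  crosses an edge of \<open>C\<close>. The order x, y, z goes around a triangle of degree
  \<open>3*a-2\<close>, the order x, z, y around one of degree \<open>3*a-1\<close>. Symmetry of
  \<open>C\<close> comes from flipping a single step.\<close>

lemma height_imp_sym_matching:
  assumes g: "height a C g" 
    and supp: "\<And>i j k. C i j k \<Longrightarrow> i + j + k = 3*a - 2 \<and> i \<in> {0..<2*a} \<and> j \<in> {0..<2*a} \<and> k \<in> {0..<2*a-1}"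
  shows "sym_matching a C"
proof -
  have comm: "C j i k" if c: "C i j k" for i j k
  proof -
    have s: "i + j + k = 3*a - 2" "i \<in> {0..<2*a}" "j \<in> {0..<2*a}" "k \<in> {0..<2*a-1}"
      using supp[OF c] by auto
    \<comment> \<open>These solve \<open>i = a+z-y\<close> and \<open>k = a-1+y-x\<close> for the
      representative with \<open>x = 0\<close> of its diagonal line.\<close>
    define y where "y = k - a + 1"
    define z where "z = y + i - a"
    have h: "hexpt a 0 y z" "hexpt a 0 y (z+1)"
      using s by (auto simp: hexpt_def y_def z_def)
    have e: "a+z-y = i" "a-1-z = j" "a-1+y = k" using s by (auto simp: y_def z_def)
    have 1: "g 0 y (z+1) = g 0 y z + 1" using height_step3[OF g h] c e by simp
    have h': "hexpt a (a+1-y) (a+1) (a-z)" "hexpt a (a+1-y) (a+1) (a-z+1)"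
      using h by (auto simp: hexpt_def)
    have e': "a + (a-z) - (a+1) = j" "a-1+(a+1-y)-(a-z) = i" "a-1+(a+1)-(a+1-y) = k"
      using e by auto
    have "g (a+1-y) (a+1) (a-z+1) = g (a+1-y) (a+1) (a-z) + of_bool (C j i k)"
      using height_step3[OF g h'] unfolding e' .
    moreover have "g (a+1-y) (a+1) (a+1-z) = 1 - g 0 y z"
      using height_flip[OF g h(1)] by simp
    moreover have "g (a+1-y) (a+1) (a-z) = 1 - g 0 y (z+1)"
      using height_flip[OF g h(2)] by simp
    moreover have "a-z+1 = a+1-z" by simp
    ultimately have "of_bool (C j i k) = (1::int)" using 1 by simp
    then show ?thesis by (simp split: if_splits)
  qed
  then have comm': "C i j k = C j i k" for i j k by blast
  have X: "of_bool (C j k i) + of_bool (C i k j) + of_bool (C i j k) = (1::int)"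
    if "i \<in> {0..<2*a}" "j \<in> {0..<2*a}" "k \<in> {0..<2*a}" "i + j + k = 3*a - 2" for i j k
  proof -
    define x y z where "x = (0::int)" and "y = k - a + 1" and "z = k + i - 2*a + 2"
    note d = x_def y_def z_def
    have "g (x+1) y z = g x y z + of_bool (C j k i)"
      by (rule height_step1'[OF g]) (use that in \<open>auto simp: hexpt_def d\<close>)
    moreover have "g (x+1) (y+1) z = g (x+1) y z + of_bool (C k i j)"
      by (rule height_step2'[OF g]) (use that in \<open>auto simp: hexpt_def d\<close>)
    moreover have "g (x+1) (y+1) (z+1) = g (x+1) (y+1) z + of_bool (C i j k)"
      by (rule height_step3'[OF g]) (use that in \<open>auto simp: hexpt_def d\<close>)
    moreover have "g (x+1) (y+1) (z+1) = g x y z + 1" by (rule height_diag[OF g])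
    ultimately show ?thesis using comm'[of k i j] by simp
  qed
  have Y: "of_bool (C j k (i-1)) + of_bool (C i k (j-1)) + of_bool (C i j (k-1)) = (1::int)"
    if "i \<in> {0..<2*a}" "j \<in> {0..<2*a}" "k \<in> {0..<2*a}" "i + j + k = 3*a - 1" for i j k
  proof -
    define x y z where "x = (0::int)" and "y = k - a + 1" and "z = k + i - 2*a + 1"
    note d = x_def y_def z_def
    have "g (x+1) y z = g x y z + of_bool (C j k (i-1))"
      by (rule height_step1'[OF g]) (use that in \<open>auto simp: hexpt_def d\<close>)
    moreover have "g (x+1) y (z+1) = g (x+1) y z + of_bool (C i j (k-1))"
      by (rule height_step3'[OF g]) (use that in \<open>auto simp: hexpt_def d\<close>)
    moreover have "g (x+1) (y+1) (z+1) = g (x+1) y (z+1) + of_bool (C k i (j-1))"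
      by (rule height_step2'[OF g]) (use that in \<open>auto simp: hexpt_def d\<close>)
    moreover have "g (x+1) (y+1) (z+1) = g x y z + 1" by (rule height_diag[OF g])
    ultimately show ?thesis using comm'[of k i "j-1"] by simp
  qed
  show ?thesis unfolding sym_matching_def using supp comm X Y by blast
qed

text \<open>The top face of the column over \<open>(x,y)\<close>, projected along \<open>(1,1,1)\<close>.\<close>

definition pp_lozenge :: "nat \<Rightarrow> (nat \<Rightarrow> nat \<Rightarrow> nat) \<Rightarrow> int \<Rightarrow> int \<Rightarrow> int \<Rightarrow> bool" where
  "pp_lozenge a \<pi> i j k \<longleftrightarrow> (\<exists>x\<in>{1..int a}. \<exists>y\<in>{1..int a}.
     i = int a + int (\<pi> (nat x) (nat y)) - y \<and> j = int a - 1 + x - int (\<pi> (nat x) (nat y)) \<and>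
     k = int a - 1 + y - x)"

text \<open>Slide along the diagonal to height 0. There the step rises exactly if it leaves the set
  \<open>g \<le> 0\<close>, that is, if \<open>z\<close> is the top \<open>\<pi> x y\<close> of its
  column. The hypotheses \<open>low\<close> and \<open>high\<close> cover the ends 0 and
  \<open>a\<close> of a column, where \<open>match\<close> says nothing.\<close>

lemma pp_lozenge_iff_step:
  fixes a :: nat
  assumes diag: "\<And>x y z. g (x+1) (y+1) (z+1) = g x y z + (1::int)"
    and step: "\<And>x y z. hexpt a x y z \<Longrightarrow> hexpt a x y (z+1) \<Longrightarrow> g x y z \<le> g x y (z+1)"
    and low: "\<And>x y z. hexpt a x y z \<Longrightarrow> min x (min y z) \<le> 0 \<Longrightarrow> max x (max y z) \<le> a \<Longrightarrow> g x y z \<le> 0"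
    and high: "\<And>x y z. hexpt a x y z \<Longrightarrow> max x (max y z) > a \<Longrightarrow> 1 \<le> g x y z"
    and match: "\<And>x y z. x \<in> {1..int a} \<Longrightarrow> y \<in> {1..int a} \<Longrightarrow> z \<in> {1..int a} \<Longrightarrow>
                 z \<le> int (\<pi> (nat x) (nat y)) \<longleftrightarrow> g x y z \<le> 0"
    and le: "\<And>x y. \<pi> x y \<le> a"
    and h: "hexpt a x y z" "hexpt a x y (z+1)"
    and up: "g x y (z+1) \<le> g x y z + 1"
  shows "pp_lozenge a \<pi> (int a + z - y) (int a - 1 + x - z) (int a - 1 + y - x) \<longleftrightarrow> g x y (z+1) = g x y z + 1"
proof
  assume "pp_lozenge a \<pi> (int a + z - y) (int a - 1 + x - z) (int a - 1 + y - x)"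
  then obtain x' y' where xy: "x' \<in> {1..int a}" "y' \<in> {1..int a}" and
    eq: "int a + z - y = int a + int (\<pi> (nat x') (nat y')) - y'"
    "int a - 1 + x - z = int a - 1 + x' - int (\<pi> (nat x') (nat y'))"
    unfolding pp_lozenge_def by blast
  define p where "p = int (\<pi> (nat x') (nat y'))"
  define t where "t = p - z"
  have p: "0 \<le> p" "p \<le> a" using le by (auto simp: p_def)
  have t: "x + t = x'" "y + t = y'" "z + t = p" "z + 1 + t = p + 1"
    using eq by (auto simp: t_def p_def)
  have "g x' y' p \<le> 0"
  proof (cases "p = 0")
    case True
    then show ?thesis using xy by (intro low) (auto simp: hexpt_def)
  next
    case False
    then show ?thesis using match[of x' y' p] xy p by (simp add: p_def)
  qed
  moreover have "1 \<le> g x' y' (p+1)"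
  proof (cases "p = a")
    case True
    then show ?thesis using xy by (intro high) (auto simp: hexpt_def)
  next
    case False
    then show ?thesis using match[of x' y' "p+1"] xy p by (simp add: p_def)
  qed
  moreover have "g x' y' p = g x y z + t"
    using diag_shift[of g 1 x t y z, OF diag] t by simp
  moreover have "g x' y' (p+1) = g x y (z+1) + t"
    using diag_shift[of g 1 x t y "z+1", OF diag] t by simp
  ultimately show "g x y (z+1) = g x y z + 1" using up by linarith
next
  assume s: "g x y (z+1) = g x y z + 1"
  define t where "t = - g x y z"
  define x' y' z' where "x' = x + t" and "y' = y + t" and "z' = z + t"
  have h': "hexpt a x' y' z'" "hexpt a x' y' (z'+1)"
    using h by (auto simp: hexpt_def x'_def y'_def z'_def)
  have g0: "g x' y' z' = 0"
    using diag_shift[of g 1 x t y z, OF diag] by (simp add: x'_def y'_def z'_def t_def)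
  have g1: "g x' y' (z'+1) = 1"
    using diag_shift[of g 1 x t y "z+1", OF diag] s
    by (simp add: x'_def y'_def z'_def t_def algebra_simps)
  have mx: "max x' (max y' z') \<le> a" using high[OF h'(1)] g0 by linarith
  have pos: "1 \<le> x'" "1 \<le> y'" "0 \<le> z'"
  proof -
    have "0 < min x' (min y' (z'+1)) \<or> int a < max x' (max y' (z'+1))"
      using low[OF h'(2)] g1 by linarith
    then show "1 \<le> x'" "1 \<le> y'" "0 \<le> z'" using mx h'(2) by (auto simp: hexpt_def)
  qed
  have xy: "x' \<in> {1..int a}" "y' \<in> {1..int a}" using pos mx by auto
  let ?p = "int (\<pi> (nat x') (nat y'))"
  have "z' \<le> ?p"
    using match[OF xy, of z'] g0 pos mx by (cases "z' = 0") auto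
  moreover have "?p \<le> z'"
  proof (cases "z' = a")
    case True
    then show ?thesis using le by simp
  next
    case False
    then show ?thesis using match[OF xy, of "z'+1"] g1 pos mx by auto
  qed
  ultimately have "?p = z'" by simp
  then show "pp_lozenge a \<pi> (int a + z - y) (int a - 1 + x - z) (int a - 1 + y - x)"
    unfolding pp_lozenge_def using xy
    by (intro bexI[of _ x'] bexI[of _ y']) (auto simp: x'_def y'_def z'_def)
qed

lemma pp_lozenge_bounds:
  assumes "pp_lozenge a \<pi> i j k" and "\<And>x y. \<pi> x y \<le> a"
  shows "i + j + k = 3 * int a - 2 \<and> i \<in> {0..<2*int a} \<and> j \<in> {0..<2*int a} \<and> k \<in> {0..<2*int a-1}"
proof -
  obtain x y where "x \<in> {1..int a}" "y \<in> {1..int a}"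
     "i = int a + int (\<pi> (nat x) (nat y)) - y" "j = int a - 1 + x - int (\<pi> (nat x) (nat y))"
     "k = int a - 1 + y - x"
    using assms(1) unfolding pp_lozenge_def by blast
  with assms(2)[of "nat x" "nat y"] show ?thesis by auto
qed

lemma height_imp_pp_lozenge:
  fixes a :: nat
  assumes g: "height a C g"
    and supp: "\<And>i j k. C i j k \<Longrightarrow> i + j + k = 3 * int a - 2 \<and> i \<in> {0..<2*int a} \<and> j \<in> {0..<2*int a} \<and> k \<in> {0..<2*int a-1}"
    and match: "\<And>x y z. x \<in> {1..int a} \<Longrightarrow> y \<in> {1..int a} \<Longrightarrow> z \<in> {1..int a} \<Longrightarrow>
                 z \<le> int (\<pi> (nat x) (nat y)) \<longleftrightarrow> g x y z \<le> 0"
    and le: "\<And>x y. \<pi> x y \<le> a"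
  shows "pp_lozenge a \<pi> = C"
proof (intro ext)
  fix i j k
  show "pp_lozenge a \<pi> i j k = C i j k"
  proof (cases "i + j + k = 3 * int a - 2 \<and> i \<in> {0..<2*int a} \<and> j \<in> {0..<2*int a} \<and> k \<in> {0..<2*int a-1}")
    case False
    then show ?thesis using supp pp_lozenge_bounds[of a \<pi> i j k] le by blast
  next
    case True
    define y z where "y = k - int a + 1" and "z = y + i - int a"
    have h: "hexpt a 0 y z" "hexpt a 0 y (z+1)"
      using True by (auto simp: hexpt_def y_def z_def)
    have e: "int a + z - y = i" "int a - 1 + 0 - z = j" "int a - 1 + y - 0 = k"
      using True by (auto simp: y_def z_def)
    have s: "g 0 y (z+1) = g 0 y z + of_bool (C i j k)"
      using height_step3[OF g h] unfolding e .
    have "pp_lozenge a \<pi> (int a + z - y) (int a - 1 + 0 - z) (int a - 1 + y - 0) \<longleftrightarrow> g 0 y (z+1) = g 0 y z + 1"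
    proof (rule pp_lozenge_iff_step[where g = g])
      show "g (x+1) (y+1) (z+1) = g x y z + 1" for x y z using height_diag[OF g] by simp
      show "g x y z \<le> g x y (z+1)" if "hexpt a x y z" "hexpt a x y (z+1)" for x y z
        using height_step3[OF g that] by simp
    qed (use height_low[OF g] height_high[OF g] match le h s in auto)
    then show ?thesis unfolding e using s by (auto split: if_splits)
  qed
qed

section \<open>Height functions and symmetric plane partitions\<close>

lemma antitone_threshold:
  fixes a :: nat
  assumes "\<And>z. 1 \<le> z \<Longrightarrow> z < a \<Longrightarrow> P (Suc z) \<Longrightarrow> P z"
  shows "\<exists>m\<le>a. \<forall>z\<in>{1..a}. z \<le> m \<longleftrightarrow> P z"
  using assms
proof (induction a)
  case (Suc a)
  then obtain m where m: "m \<le> a" "\<forall>z\<in>{1..a}. z \<le> m \<longleftrightarrow> P z" by (metis less_SucI)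
  show ?case
  proof (cases "P (Suc a)")
    case False
    then show ?thesis using m by (intro exI[of _ m]) (auto simp: le_Suc_eq)
  next
    case True
    have "P z" if "1 \<le> z" "z \<le> Suc a" for z
      using that(2,1) by (induction rule: inc_induct) (use True Suc.prems in auto)
    then show ?thesis by (intro exI[of _ "Suc a"]) auto
  qed
qed simp

text \<open>\<open>\<pi> x y\<close> is the threshold at which the column over \<open>(x,y)\<close>
  leaves the set \<open>g \<le> 0\<close>. Monotonicity of \<open>g\<close> along the axes gives a
  plane partition, rotation invariance the cyclic symmetry, and the flip the
  complementation.\<close>

lemma height_imp_CSTCPP:
  fixes a :: nat
  assumes g: "height a C g"
  obtains \<pi> where "\<pi> \<in> CSTCPP a"
    "\<And>x y z. x \<in> {1..int a} \<Longrightarrow> y \<in> {1..int a} \<Longrightarrow> z \<in> {1..int a} \<Longrightarrow>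
       z \<le> int (\<pi> (nat x) (nat y)) \<longleftrightarrow> g x y z \<le> 0"
proof -
  have hex: "hexpt a (int x) (int y) (int z)" if "x \<in> {1..a}" "y \<in> {1..a}" "z \<in> {1..a}" for x y z
    using that by (auto simp: hexpt_def)
  have "\<exists>m\<le>a. \<forall>z\<in>{1..a}. z \<le> m \<longleftrightarrow> g (int x) (int y) (int z) \<le> 0"
    if "x \<in> {1..a}" "y \<in> {1..a}" for x y
  proof (rule antitone_threshold)
    fix z assume z: "1 \<le> z" "z < a" "g (int x) (int y) (int (Suc z)) \<le> 0"
    then show "g (int x) (int y) (int z) \<le> 0"
      using height_mono(3)[OF g hex[OF that, of z]] hex[OF that, of "Suc z"] by (simp add: add.commute)
  qed
  then obtain m where m: "\<And>x y. x \<in> {1..a} \<Longrightarrow> y \<in> {1..a} \<Longrightarrow>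
      m x y \<le> a \<and> (\<forall>z\<in>{1..a}. z \<le> m x y \<longleftrightarrow> g (int x) (int y) (int z) \<le> 0)"
    by metis
  define \<pi> where "\<pi> x y = (if x \<in> {1..a} \<and> y \<in> {1..a} then m x y else 0)" for x y
  have le: "\<pi> x y \<le> a" for x y using m by (auto simp: \<pi>_def)
  have mt: "z \<le> \<pi> x y \<longleftrightarrow> g (int x) (int y) (int z) \<le> 0"
    if "x \<in> {1..a}" "y \<in> {1..a}" "z \<in> {1..a}" for x y z
    using m that by (auto simp: \<pi>_def)
  have "plane_partition a \<pi>"
    unfolding plane_partition_def
  proof (intro conjI allI impI)
    fix i j assume ij: "i \<in> {1..a} \<and> j \<in> {1..<a}"
    show "\<pi> i (j+1) \<le> \<pi> i j"
    proof (cases "\<pi> i (j+1) = 0")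
      case False
      then have z: "\<pi> i (j+1) \<in> {1..a}" using le by auto
      have "g (int i) (int (j+1)) (int (\<pi> i (j+1))) \<le> 0"
        using mt[of i "j+1", OF _ _ z] ij by auto
      then have "g (int i) (int j) (int (\<pi> i (j+1))) \<le> 0"
        using height_mono(2)[OF g hex[of i j, OF _ _ z]] hex[of i "j+1", OF _ _ z] ij by (simp add: add.commute)
      then show ?thesis using mt[of i j, OF _ _ z] ij by auto
    qed simp
  next
    fix i j assume ij: "i \<in> {1..<a} \<and> j \<in> {1..a}"
    show "\<pi> (i+1) j \<le> \<pi> i j"
    proof (cases "\<pi> (i+1) j = 0")
      case False
      then have z: "\<pi> (i+1) j \<in> {1..a}" using le by auto
      have "g (int (i+1)) (int j) (int (\<pi> (i+1) j)) \<le> 0"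
        using mt[of "i+1" j, OF _ _ z] ij by auto
      then have "g (int i) (int j) (int (\<pi> (i+1) j)) \<le> 0"
        using height_mono(1)[OF g hex[of i j, OF _ _ z]] hex[of "i+1" j, OF _ _ z] ij by (simp add: add.commute)
      then show ?thesis using mt[of i j, OF _ _ z] ij by auto
    qed simp
  qed (use le in \<open>auto simp: \<pi>_def\<close>)
  moreover have "cyclically_symmetric a \<pi>"
  proof -
    have rot: "(j,k,i) \<in> pp_set a \<pi> \<longleftrightarrow> (i,j,k) \<in> pp_set a \<pi>" for i j k
    proof (cases "i \<in> {1..a} \<and> j \<in> {1..a} \<and> k \<in> {1..a}")
      case True
      then show ?thesis
        using mt[of i j k] mt[of j k i] height_cyc[OF g hex[of i j k]] by (auto simp: pp_set_def)
    qed (auto simp: pp_set_def)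
    show ?thesis unfolding cyclically_symmetric_def
    proof (intro subset_antisym subsetI)
      fix p assume p: "p \<in> pp_set a \<pi>"
      obtain i j k where [simp]: "p = (i,j,k)" by (cases p)
      have "(k,i,j) \<in> pp_set a \<pi>" using p rot by simp
      then show "p \<in> (\<lambda>(i, j, k). (j, k, i)) ` pp_set a \<pi>"
        by (intro image_eqI[of _ _ "(k,i,j)"]) auto
    qed (use rot in auto)
  qed
  moreover have "transpose_complementary a \<pi>"
    unfolding transpose_complementary_def
  proof (intro ballI)
    fix i j assume ij: "i \<in> {1..a}" "j \<in> {1..a}"
    define A B where "A = \<pi> j i" and "B = \<pi> (a+1-i) (a+1-j)"
    \<comment> \<open>Evaluated at \<open>z = A\<close> and at \<open>z = A + 1\<close>, this
      equivalence bounds \<open>A + B\<close> by \<open>a\<close> from both sides.\<close>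
    have *: "z \<le> A \<longleftrightarrow> \<not> a + 1 - z \<le> B" if z: "z \<in> {1..a}" for z
    proof -
      have i': "a+1-i \<in> {1..a}" "a+1-j \<in> {1..a}" "a+1-z \<in> {1..a}" using ij z by auto
      have e: "int (a+1-i) = int a + 1 - int i" "int (a+1-j) = int a + 1 - int j"
         "int (a+1-z) = int a + 1 - int z" using ij z by auto
      show ?thesis
        using mt[OF ij(2,1) z] mt[OF i'] height_flip[OF g hex[OF ij(2,1) z]]
        unfolding A_def B_def e by linarith
    qed
    have "A \<le> a" "B \<le> a" using le by (auto simp: A_def B_def)
    moreover have "A + B \<le> a" using *[of A] calculation by (cases "A = 0") auto
    moreover have "a \<le> A + B" using *[of "Suc A"] calculation by (cases "A = a") auto
    ultimately show "int (\<pi> j i) = int a - int (\<pi> (a + 1 - i) (a + 1 - j))"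
      by (simp add: A_def B_def)
  qed
  ultimately have "\<pi> \<in> CSTCPP a" by (simp add: CSTCPP_def)
  moreover have "z \<le> int (\<pi> (nat x) (nat y)) \<longleftrightarrow> g x y z \<le> 0"
    if "x \<in> {1..int a}" "y \<in> {1..int a}" "z \<in> {1..int a}" for x y z
  proof -
    have "nat x \<in> {1..a}" "nat y \<in> {1..a}" "nat z \<in> {1..a}" using that by auto
    from mt[OF this] that show ?thesis by auto
  qed
  ultimately show thesis using that by blast
qed

lemma int_threshold:
  fixes P :: "int \<Rightarrow> bool"
  assumes anti: "\<And>t. P t \<Longrightarrow> P (t+1)" and "\<not> P l" and "P u"
  shows "\<exists>m. \<forall>t. P t \<longleftrightarrow> m \<le> t"
proof -
  have mono: "P t" if "P s" "s \<le> t" for s t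
    using that(2,1) by (induction rule: int_ge_induct) (auto intro: anti)
  have lu: "l < u" using mono[of u l] assms by force
  define n where "n = (LEAST n. P (l + int n))"
  have ex: "P (l + int (nat (u - l)))" using lu \<open>P u\<close> by simp
  have n: "P (l + int n)" unfolding n_def by (rule LeastI[where P="\<lambda>n. P (l + int n)", OF ex])
  have "P t \<longleftrightarrow> l + int n \<le> t" for t
  proof
    assume t: "P t"
    show "l + int n \<le> t"
    proof (rule ccontr)
      assume "\<not> l + int n \<le> t"
      moreover have "l \<le> t" using mono[OF t, of l] \<open>\<not> P l\<close> by linarith
      ultimately have "nat (t - l) < n" "P (l + int (nat (t-l)))" using t by auto
      then show False unfolding n_def by (metis not_less_Least)
    qed
  qed (use mono n in blast)
  then show ?thesis by blast
qed

text \<open>The height of a point is the least \<open>t\<close> for which lowering it by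
  \<open>t\<close> along \<open>(1,1,1)\<close> lands in the down-set \<open>S\<close>. This
  characterisation translates every property of \<open>S\<close> into one of
  \<open>g\<close>.\<close>

lemma CSTCPP_imp_height:
  fixes a :: nat
  assumes pi: "\<pi> \<in> CSTCPP a"
  obtains g where "height a (pp_lozenge a \<pi>) g"
    "\<And>x y z. x \<in> {1..int a} \<Longrightarrow> y \<in> {1..int a} \<Longrightarrow> z \<in> {1..int a} \<Longrightarrow>
       z \<le> int (\<pi> (nat x) (nat y)) \<longleftrightarrow> g x y z \<le> 0"
proof -
  have pp: "plane_partition a \<pi>" and cs: "cyclically_symmetric a \<pi>" 
    and tc: "transpose_complementary a \<pi>" using pi by (auto simp: CSTCPP_def)
  have le: "\<pi> x y \<le> a" for x y using pp by (simp add: plane_partition_def)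
  define B where "B = {1..int a}"
  define P where "P x y = int (\<pi> (nat x) (nat y))" for x y :: int
  \<comment> \<open>The cubes of \<open>\<pi>\<close>, extended by the three walls to a down-set of \<open>\<int>\<^sup>3\<close>.\<close>
  define S where "S x y z \<longleftrightarrow> x \<le> a \<and> y \<le> a \<and> z \<le> a \<and> (x \<le> 0 \<or> y \<le> 0 \<or> z \<le> 0 \<or> z \<le> P x y)" for x y z :: int
  have S1: "S x y z" if "S (x+1) y z" for x y z
  proof -
    have "P (x+1) y \<le> P x y" if "1 \<le> x" "x + 1 \<le> a" "1 \<le> y" "y \<le> a"
    proof -
      have "nat x \<in> {1..<a} \<and> nat y \<in> {1..a}" "nat (x+1) = nat x + 1" using that by auto
      then show ?thesis using pp by (simp add: plane_partition_def P_def)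
    qed
    then show ?thesis using that by (fastforce simp: S_def)
  qed
  have S2: "S x y z" if "S x (y+1) z" for x y z
  proof -
    have "P x (y+1) \<le> P x y" if "1 \<le> y" "y + 1 \<le> a" "1 \<le> x" "x \<le> a"
    proof -
      have "nat y \<in> {1..<a} \<and> nat x \<in> {1..a}" "nat (y+1) = nat y + 1" using that by auto
      then show ?thesis using pp by (simp add: plane_partition_def P_def)
    qed
    then show ?thesis using that by (fastforce simp: S_def)
  qed
  have S3: "S x y z" if "S x y (z+1)" for x y z
    using that by (auto simp: S_def)
  have cyc: "S y z x \<longleftrightarrow> S x y z" for x y z
  proof (cases "x \<in> B \<and> y \<in> B \<and> z \<in> B")
    case True
    have mem: "S x y z \<longleftrightarrow> (nat x, nat y, nat z) \<in> pp_set a \<pi>" if "x \<in> B \<and> y \<in> B \<and> z \<in> B" for x y z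
      using that by (auto simp: S_def pp_set_def P_def B_def nat_le_iff)
    have "(j,k,i) \<in> pp_set a \<pi> \<longleftrightarrow> (i,j,k) \<in> pp_set a \<pi>" for i j k
    proof -
      have "(j,k,i) \<in> (\<lambda>(i, j, k). (j, k, i)) ` pp_set a \<pi> \<longleftrightarrow> (i,j,k) \<in> pp_set a \<pi>" by force
      then show ?thesis using cs by (simp add: cyclically_symmetric_def)
    qed
    then show ?thesis using mem True by simp
  qed (auto simp: S_def B_def)
  \<comment> \<open>Outside the box, a point of the hexagon with a coordinate \<le> 0 has none above
    \<open>a\<close> and lies in \<open>S\<close>, while one with a coordinate above
    \<open>a\<close> does not; the flip exchanges the two kinds.\<close>
  have flip: "S (int a+1-y) (int a+1-x) (int a+1-z) \<longleftrightarrow> \<not> S x y z" if h: "hexpt a x y z" for x y z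
  proof (cases "x \<in> B \<and> y \<in> B \<and> z \<in> B")
    case True
    then have r: "nat x \<in> {1..a}" "nat y \<in> {1..a}" "a + 1 - nat y = nat (int a+1-y)" "a + 1 - nat x = nat (int a+1-x)"
      by (auto simp: B_def)
    have "P x y = a - P (int a+1-y) (int a+1-x)"
      using tc r unfolding transpose_complementary_def P_def by metis
    then show ?thesis using True by (auto simp: S_def B_def)
  next
    case False
    then show ?thesis using h by (auto simp: S_def B_def hexpt_def)
  qed
  have "\<exists>m. \<forall>t. S (x-t) (y-t) (z-t) \<longleftrightarrow> m \<le> t" for x y z
  proof (rule int_threshold)
    show "S (x-(t+1)) (y-(t+1)) (z-(t+1))" if "S (x-t) (y-t) (z-t)" for t
      using S1[of "x-(t+1)" "y-(t+1)" "z-(t+1)"] S2[of "x-t" "y-(t+1)" "z-(t+1)"]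
        S3[of "x-t" "y-t" "z-(t+1)"] that by (simp add: algebra_simps)
    show "\<not> S (x-(x-a-1)) (y-(x-a-1)) (z-(x-a-1))" by (simp add: S_def)
    show "S (x - max x (max y z)) (y - max x (max y z)) (z - max x (max y z))"
      by (auto simp: S_def)
  qed
  then obtain g where g: "\<And>x y z t. S (x-t) (y-t) (z-t) \<longleftrightarrow> g x y z \<le> t" by metis
  have eqI: "m = n" if "\<And>t. m \<le> t \<longleftrightarrow> n \<le> t" for m n :: int
    using that[of m] that[of n] by simp
  have diag: "g (x+1) (y+1) (z+1) = g x y z + 1" for x y z
  proof (rule eqI)
    fix t
    show "g (x+1) (y+1) (z+1) \<le> t \<longleftrightarrow> g x y z + 1 \<le> t"
      using g[of "x+1" t "y+1" "z+1"] g[of x "t-1" y z] by (simp add: algebra_simps)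
  qed
  have g0: "S x y z \<longleftrightarrow> g x y z \<le> 0" for x y z using g[of x 0 y z] by simp
  have m1: "g x y z \<le> g (x+1) y z" for x y z
    using g[of "x+1" "g (x+1) y z" y z] g[of x "g (x+1) y z" y z] S1 by (simp add: algebra_simps)
  have m2: "g x y z \<le> g x (y+1) z" for x y z
    using g[of x "g x (y+1) z" "y+1" z] g[of x "g x (y+1) z" y z] S2 by (simp add: algebra_simps)
  have m3: "g x y z \<le> g x y (z+1)" for x y z
    using g[of x "g x y (z+1)" y "z+1"] g[of x "g x y (z+1)" y z] S3 by (simp add: algebra_simps)
  \<comment> \<open>A step in direction z is part of a diagonal step, which raises the height by
    exactly 1.\<close>
  have up: "g x y (z+1) \<le> g x y z + 1" for x y z
    using m1[of x y "z+1"] m2[of "x+1" y "z+1"] diag[of x y z] by simp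
  have low: "g x y z \<le> 0" if "min x (min y z) \<le> 0" "max x (max y z) \<le> int a" for x y z
    using that g0[of x y z] by (auto simp: S_def)
  have high: "1 \<le> g x y z" if "max x (max y z) > int a" for x y z
    using that g0[of x y z] by (auto simp: S_def)
  have match: "z \<le> int (\<pi> (nat x) (nat y)) \<longleftrightarrow> g x y z \<le> 0" if "x \<in> {1..int a}" "y \<in> {1..int a}" "z \<in> {1..int a}" for x y z
    using that g0[of x y z] by (auto simp: S_def P_def)
  have "height a (pp_lozenge a \<pi>) g"
    unfolding height_def
  proof (intro conjI allI impI)
    fix x y z assume h: "hexpt a x y z" "hexpt a x y (z+1)"
    have "pp_lozenge a \<pi> (int a + z - y) (int a - 1 + x - z) (int a - 1 + y - x) \<longleftrightarrow> g x y (z+1) = g x y z + 1"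
      using h up diag m3 low high match le by (intro pp_lozenge_iff_step[where g=g]) auto
    then show "g x y (z+1) = g x y z + of_bool (pp_lozenge a \<pi> (int a + z - y) (int a - 1 + x - z) (int a - 1 + y - x))"
      using up[of x y z] m3[of x y z] by auto
  next
    fix x y z
    show "g y z x = g x y z"
      by (rule eqI) (simp add: g[symmetric] cyc)
  next
    fix x y z assume h: "hexpt a x y z"
    show "g (int a+1-y) (int a+1-x) (int a+1-z) = 1 - g x y z"
    proof (rule eqI)
      fix t
      have "g (int a+1-y) (int a+1-x) (int a+1-z) \<le> t \<longleftrightarrow> S (int a+1-(y+t)) (int a+1-(x+t)) (int a+1-(z+t))"
        using g[of "int a+1-y" t "int a+1-x" "int a+1-z"] by (simp add: algebra_simps)
      also have "\<dots> \<longleftrightarrow> \<not> S (x+t) (y+t) (z+t)"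
        by (rule flip) (use h in \<open>simp add: hexpt_def\<close>)
      also have "\<dots> \<longleftrightarrow> 1 - g x y z \<le> t" using g[of x "-t" y z] by auto
      finally show "g (int a+1-y) (int a+1-x) (int a+1-z) \<le> t \<longleftrightarrow> 1 - g x y z \<le> t" .
    qed
  qed (use diag low in auto)
  then show thesis using match that by blast
qed

section \<open>Integrating a symmetric matching to a height function\<close>

lemma sum_int_head:
  fixes f :: "int \<Rightarrow> int"
  shows "p < q \<Longrightarrow> sum f {p..<q} = f p + sum f {p+1..<q}"
proof -
  assume "p < q"
  then have "{p..<q} = insert p {p+1..<q}" by auto
  then show ?thesis by simp
qed

text \<open>On the boundary \<open>z = min x y + a\<close> the height is \<open>min x y\<close>;
  subtracting the edges crossed on the way down in direction z gives an explicit \<open>g\<close>.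
  The steps in direction z are then immediate, those in direction x come from comparing neighbouring
  rows, and those in direction y from the condition at a triangle.\<close>

lemma sym_matching_imp_height:
  fixes a :: int
  assumes M: "sym_matching a C" and a: "1 \<le> a"
  shows "\<exists>g. height a C g"
proof -
  have supp: "i + j + k = 3*a - 2 \<and> i \<in> {0..<2*a} \<and> j \<in> {0..<2*a} \<and> k \<in> {0..<2*a-1}" if "C i j k" for i j k
    using M that unfolding sym_matching_def by blast
  have comm: "C i j k \<longleftrightarrow> C j i k" for i j k
    using M unfolding sym_matching_def by blast
  have X: "of_bool (C j k i) + of_bool (C i k j) + of_bool (C i j k) = (1::int)"
    if "i \<in> {0..<2*a}" "j \<in> {0..<2*a}" "k \<in> {0..<2*a}" "i + j + k = 3*a - 2" for i j k
    using M that unfolding sym_matching_def by blast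
  have Y: "of_bool (C j k (i-1)) + of_bool (C i k (j-1)) + of_bool (C i j (k-1)) = (1::int)"
    if "i \<in> {0..<2*a}" "j \<in> {0..<2*a}" "k \<in> {0..<2*a}" "i + j + k = 3*a - 1" for i j k
    using M that unfolding sym_matching_def by blast
  \<comment> \<open>The number of edges leaving row \<open>k\<close> upwards at positions \<open>\<ge> p\<close>; comparing the triangles of
    both kinds in row \<open>k\<close> at positions \<open>\<ge> p\<close> relates \<open>N k p\<close> to \<open>N (k-1) p\<close>.\<close>
  define N :: "int \<Rightarrow> int \<Rightarrow> int" where "N k p = (\<Sum>i\<in>{p..<2*a}. of_bool (C i (3*a-2-k-i) k))" for k p
  have N_step: "N k p = of_bool (C p (3*a-2-k-p) k) + N k (p+1)" if "p < 2*a" for k p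
    unfolding N_def by (rule sum_int_head[OF that])
  have N_0: "N k p = 0" if "\<And>i. p \<le> i \<Longrightarrow> \<not> C i (3*a-2-k-i) k" for k p
    unfolding N_def using that by (intro sum.neutral) auto
  \<comment> \<open>Downward induction from the right end of row \<open>k\<close>, which is
    \<open>2*a\<close> for \<open>k < a\<close> and \<open>3*a-1-k\<close> from \<open>k = a\<close>
    on. In the second case a triangle of degree \<open>3*a-1\<close> closes the row; this causes the
    term \<open>of_bool (a \<le> k)\<close>, which reappears as the increment of
    \<open>min x y\<close> when \<open>x\<close> grows.\<close>
  have row: "of_bool (a \<le> k) + N k p - N (k-1) p = of_bool (C (3*a-1-k-p) k (p-1))"
    if "p \<le> min (2*a) (3*a-1-k)" "0 \<le> p" "a - k \<le> p" "0 \<le> k" "k < 2*a" for k p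
    using that
  proof (induction p rule: int_le_induct)
    case base
    show ?case
    proof (cases "a \<le> k")
      case False
      then have e: "min (2*a) (3*a-1-k) = 2*a" by simp
      show ?thesis unfolding e using supp False by (auto simp: N_def dest!: supp)
    next
      case True
      define p where "p = 3*a-1-k"
      have e: "min (2*a) (3*a-1-k) = p" using True by (simp add: p_def)
      have "N k p = 0" by (rule N_0) (auto dest!: supp simp: p_def)
      moreover have "N (k-1) p = of_bool (C p 0 (k-1))"
      proof -
        have "N (k-1) (p+1) = 0" by (rule N_0) (auto dest!: supp simp: p_def)
        then show ?thesis using N_step[of p "k-1"] True by (simp add: p_def)
      qed
      moreover have "of_bool (C 0 k (p-1)) + of_bool (C p k (-1)) + of_bool (C p 0 (k-1)) = (1::int)"
        using Y[of p 0 k] that True by (auto simp: p_def)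
      moreover have "\<not> C p k (-1)" by (auto dest!: supp)
      ultimately show ?thesis unfolding e using True by (simp add: p_def)
    qed
  next
    case (step p)
    define q where "q = p - 1"
    define j where "j = 3*a-1-k-q"
    have r: "q \<in> {0..<2*a}" "j \<in> {1..<2*a}" "k \<in> {0..<2*a}" using step unfolding q_def j_def by auto
    have IH: "of_bool (a \<le> k) + N k (q+1) - N (k-1) (q+1) = of_bool (C (j-1) k q)"
      using step unfolding q_def j_def by (simp add: algebra_simps)
    have "N k q = of_bool (C q (j-1) k) + N k (q+1)"
      using N_step[of q k] r by (simp add: j_def algebra_simps)
    moreover have "N (k-1) q = of_bool (C q j (k-1)) + N (k-1) (q+1)"
      using N_step[of q "k-1"] r by (simp add: j_def algebra_simps)
    moreover have "of_bool (C (j-1) k q) + of_bool (C q k (j-1)) + of_bool (C q (j-1) k) = (1::int)"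
      using X[of q "j-1" k] r by (simp add: j_def)
    moreover have "of_bool (C j k (q-1)) + of_bool (C q k (j-1)) + of_bool (C q j (k-1)) = (1::int)"
      using Y[of q j k] r by (simp add: j_def)
    ultimately have "of_bool (a \<le> k) + N k q - N (k-1) q = of_bool (C j k (q-1))"
      using IH by linarith
    then show ?case by (simp add: q_def j_def)
  qed
  define g where "g x y z = min x y - N (a-1+y-x) (a+z-y)" for x y z
  have diag: "g (x+1) (y+1) (z+1) = g x y z + 1" for x y z
  proof -
    have "a - 1 + (y+1) - (x+1) = a - 1 + y - x" "a + (z+1) - (y+1) = a + z - y" by auto
    moreover have "min (x+1) (y+1) = min x y + 1" by simp
    ultimately show ?thesis unfolding g_def by presburger
  qed
  have s3: "g x y (z+1) = g x y z + of_bool (C (a+z-y) (a-1+x-z) (a-1+y-x))"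
    if "hexpt a x y z" "hexpt a x y (z+1)" for x y z
  proof -
    have "N (a-1+y-x) (a+z-y) = of_bool (C (a+z-y) (a-1+x-z) (a-1+y-x)) + N (a-1+y-x) (a+(z+1)-y)"
    proof -
      have "a+z-y < 2*a" using that by (auto simp: hexpt_def)
      from N_step[OF this, of "a-1+y-x"] show ?thesis by (simp add: algebra_simps)
    qed
    then show ?thesis by (simp add: g_def)
  qed
  have s1: "g (x+1) y z = g x y z + of_bool (C (a+x-z) (a-1+y-x) (a-1+z-y))"
    if "hexpt a x y z" "hexpt a (x+1) y z" for x y z
  proof -
    have r: "of_bool (a \<le> a-1+y-x) + N (a-1+y-x) (a+z-y) - N (a-1+y-x-1) (a+z-y) =
       of_bool (C (3*a-1-(a-1+y-x)-(a+z-y)) (a-1+y-x) (a+z-y-1))"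
      using that by (intro row) (auto simp: hexpt_def)
    have e: "3*a-1-(a-1+y-x)-(a+z-y) = a+x-z" "a+z-y-1 = a-1+z-y" "a-1+y-x-1 = a-1+y-(x+1)" by auto
    have "min (x+1) y = min x y + of_bool (a \<le> a-1+y-x)" by auto
    then show ?thesis unfolding g_def using r[unfolded e] by linarith
  qed
  \<comment> \<open>The step is one side of a triangle whose other two sides are already known. On
    the boundary \<open>x - z = -a\<close> the triangle used in general sticks out of the hexagon,
    and the one on the other side of the step replaces it.\<close>
  have s2: "g x (y+1) z = g x y z + of_bool (C (a+y-x) (a-1+z-y) (a-1+x-z))"
    if h: "hexpt a x y z" "hexpt a x (y+1) z" for x y z
  proof (cases "x - z = - a")
    case False
    define i j k where "i = a-1+z-y" and "j = a-1+x-z" and "k = a+y-x"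
    have r: "i \<in> {0..<2*a}" "j \<in> {0..<2*a}" "k \<in> {0..<2*a}" "i + j + k = 3*a - 2"
      using h False by (auto simp: hexpt_def i_def j_def k_def)
    have "g (x-1+1) y z = g (x-1) y z + of_bool (C (a+(x-1)-z) (a-1+y-(x-1)) (a-1+z-y))"
      using h False by (intro s1) (auto simp: hexpt_def)
    moreover have "g x (y+1) (z+1) = g x (y+1) z + of_bool (C (a+z-(y+1)) (a-1+x-z) (a-1+(y+1)-x))"
      using h False by (intro s3) (auto simp: hexpt_def)
    moreover have "a+(x-1)-z = j" "a-1+y-(x-1) = k" "a+z-(y+1) = i" "a-1+(y+1)-x = k"
      by (auto simp: i_def j_def k_def)
    moreover have "g (x-1+1) (y+1) (z+1) = g (x-1) y z + 1" by (rule diag)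
    ultimately show ?thesis using X[OF r] comm[of i k j] unfolding i_def[symmetric] j_def[symmetric] k_def[symmetric]
      by simp
  next
    case True
    define i k where "i = a-1+z-y" and "k = a+y-x"
    have r: "i \<in> {0..<2*a}" "0 \<in> {0..<2*a}" "k \<in> {0..<2*a}" "i + 0 + k = 3*a - 1"
      using h True a by (auto simp: hexpt_def i_def k_def)
    have e: "a+x-z = 0" "a-1+(y+1)-x = k" "a-1+z-(y+1) = i-1" "a+z-(y+1) = i" "a-1+(x+1)-z = 0"
      "a-1+(y+1)-(x+1) = k-1" "a-1+x-z=0-1" "a+y-x = k" "a-1+z-y = i" using True by (auto simp: i_def k_def)
    have hh: "hexpt a (x+1) (y+1) z" "hexpt a (x+1) (y+1) (z+1)"
      using h True a by (auto simp: hexpt_def)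
    show ?thesis
      using s1[OF h(2) hh(1)] s3[OF hh] Y[OF r] comm[of i k "0-1"] diag[of x y z] unfolding e by simp
  qed
  have cyc: "g y z x = g x y z" if h: "hexpt a x y z" for x y z
  proof -
    have "g y z x - g x y z = g 0 0 0 - g 0 0 0"
    proof (rule hexpt_constant[where F = "\<lambda>x y z. g y z x - g x y z", OF _ _ _ _ h])
      fix x y z
      show "g (y+1) (z+1) (x+1) - g (x+1) (y+1) (z+1) = g y z x - g x y z" using diag by simp
      assume h: "hexpt a x y z"
      then have h': "hexpt a y z x" by (auto simp: hexpt_def)
      show "g y z (x+1) - g (x+1) y z = g y z x - g x y z" if "hexpt a (x+1) y z"
      proof -
        have "hexpt a y z (x+1)" using that by (auto simp: hexpt_def)
        then show ?thesis using s3[OF h'] s1[OF h that] by simp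
      qed
      show "g (y+1) z x - g x (y+1) z = g y z x - g x y z" if "hexpt a x (y+1) z"
      proof -
        have "hexpt a (y+1) z x" using that by (auto simp: hexpt_def)
        then show ?thesis using s1[OF h'] s2[OF h that] by simp
      qed
      show "g y (z+1) x - g x y (z+1) = g y z x - g x y z" if "hexpt a x y (z+1)"
      proof -
        have "hexpt a y (z+1) x" using that by (auto simp: hexpt_def)
        then show ?thesis using s2[OF h'] s3[OF h that] by simp
      qed
    qed
    then show ?thesis by simp
  qed
  have edge: "N k p = 0" if "k = -1 \<or> k = 2*a-1" for k p
    using that by (intro N_0) (auto dest!: supp)
  \<comment> \<open>The flip reverses each step and carries its edge to the mirror image, which
    \<open>comm\<close> identifies with the edge itself, so \<open>F\<close> is constant. At
    \<open>(0,a,0)\<close> both heights involve only row \<open>2*a-1\<close>, which has no upward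
    edges, and \<open>F\<close> is 1.\<close>
  have flip: "g (a+1-y) (a+1-x) (a+1-z) = 1 - g x y z" if h: "hexpt a x y z" for x y z
  proof -
    define F where "F x y z = g (a+1-y) (a+1-x) (a+1-z) + g x y z" for x y z
    have const: "F x y z = F 0 0 0" if h: "hexpt a x y z" for x y z
    proof (rule hexpt_constant[where F = F, OF _ _ _ _ h])
      fix x y z
      show "F (x+1) (y+1) (z+1) = F x y z" 
        using diag[of x y z] diag[of "a-y" "a-x" "a-z"] by (simp add: F_def algebra_simps)
      assume h: "hexpt a x y z"
      show "F (x+1) y z = F x y z" if h': "hexpt a (x+1) y z"
      proof -
        have r: "g (a+1-y) (a-x+1) (a+1-z) = g (a+1-y) (a-x) (a+1-z) +
          of_bool (C (a+(a-x)-(a+1-y)) (a-1+(a+1-z)-(a-x)) (a-1+(a+1-y)-(a+1-z)))"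
          using h h' by (intro s2) (auto simp: hexpt_def)
        have e: "a+(a-x)-(a+1-y) = a-1+y-x" "a-1+(a+1-z)-(a-x) = a+x-z" "a-1+(a+1-y)-(a+1-z) = a-1+z-y"
          "a-x+1 = a+1-x" "a+1-(x+1) = a-x" by auto
        show ?thesis using r[unfolded e, unfolded comm[of "a-1+y-x" "a+x-z"]] s1[OF h h'] unfolding F_def e by linarith
      qed
      show "F x (y+1) z = F x y z" if h': "hexpt a x (y+1) z"
      proof -
        have r: "g (a-y+1) (a+1-x) (a+1-z) = g (a-y) (a+1-x) (a+1-z) +
          of_bool (C (a+(a-y)-(a+1-z)) (a-1+(a+1-x)-(a-y)) (a-1+(a+1-z)-(a+1-x)))"
          using h h' by (intro s1) (auto simp: hexpt_def)
        have e: "a+(a-y)-(a+1-z) = a-1+z-y" "a-1+(a+1-x)-(a-y) = a+y-x" "a-1+(a+1-z)-(a+1-x) = a-1+x-z"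
          "a-y+1 = a+1-y" "a+1-(y+1) = a-y" by auto
        show ?thesis using r[unfolded e, unfolded comm[of "a-1+z-y" "a+y-x"]] s2[OF h h'] unfolding F_def e by linarith
      qed
      show "F x y (z+1) = F x y z" if h': "hexpt a x y (z+1)"
      proof -
        have r: "g (a+1-y) (a+1-x) (a-z+1) = g (a+1-y) (a+1-x) (a-z) +
          of_bool (C (a+(a-z)-(a+1-x)) (a-1+(a+1-y)-(a-z)) (a-1+(a+1-x)-(a+1-y)))"
          using h h' by (intro s3) (auto simp: hexpt_def)
        have e: "a+(a-z)-(a+1-x) = a-1+x-z" "a-1+(a+1-y)-(a-z) = a+z-y" "a-1+(a+1-x)-(a+1-y) = a-1+y-x"
          "a-z+1 = a+1-z" "a+1-(z+1) = a-z" by auto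
        show ?thesis using r[unfolded e, unfolded comm[of "a-1+x-z" "a+z-y"]] s3[OF h h'] unfolding F_def e by linarith
      qed
    qed
    have "F 0 a 0 = 1" using a by (simp add: F_def g_def edge)
    moreover have "hexpt a 0 a 0" using a by (simp add: hexpt_def)
    ultimately have "F x y z = 1" using const[OF h] const[of 0 a 0] by simp
    then show ?thesis by (simp add: F_def)
  qed
  have low0: "g 0 y z \<le> 0" if "y \<in> {0..a}" "z \<in> {0..a}" for y z
  proof -
    have "g 0 y z \<le> g 0 a z"
      by (rule int_interval_mono[where f="\<lambda>t. g 0 t z"])
        (use that s2 in \<open>auto simp: hexpt_def\<close>)
    also have "\<dots> = 0" using a by (simp add: g_def edge)
    finally show ?thesis .
  qed
  have low: "g x y z \<le> 0" if h: "hexpt a x y z" and m: "min x (min y z) \<le> 0" for x y z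
  proof -
    define m where "m = min x (min y z)"
    define x' y' z' where "x' = x - m" and "y' = y - m" and "z' = z - m"
    have r: "x' \<in> {0..a}" "y' \<in> {0..a}" "z' \<in> {0..a}" "x' = 0 \<or> y' = 0 \<or> z' = 0"
      using h by (auto simp: hexpt_def x'_def y'_def z'_def m_def)
    then have "hexpt a x' y' z'" "hexpt a y' z' x'" by (auto simp: hexpt_def)
    then have "g y' z' x' = g x' y' z'" "g z' x' y' = g x' y' z'" using cyc by simp_all
    then have "g x' y' z' \<le> 0" using r low0[of y' z'] low0[of z' x'] low0[of x' y'] by auto
    moreover have "g x y z = g x' y' z' + m"
      using diag_shift[of g 1 x' m y' z', OF diag] by (simp add: x'_def y'_def z'_def)
    ultimately show ?thesis using m m_def by simp
  qed
  have "height a C g"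
    unfolding height_def by (intro conjI allI impI diag s3 cyc flip low)
  then show ?thesis by blast
qed

text \<open>\<open>pp_lozenge a\<close> is the bijection. It is injective because its value
  determines the height function on the hexagon, which recovers \<open>\<pi>\<close>; it is
  surjective because every symmetric matching has a height function.\<close>

lemma card_CSTCPP_eq_card_sym_matching:
  fixes a :: nat
  assumes a: "0 < a"
  shows "card (CSTCPP a) = card {C. sym_matching a C}"
proof (rule bij_betw_same_card, unfold bij_betw_def, intro conjI)
  have le: "\<pi> x y \<le> a" if "\<pi> \<in> CSTCPP a" for \<pi> x y
    using that by (simp add: CSTCPP_def plane_partition_def)
  show "inj_on (pp_lozenge a) (CSTCPP a)"
  proof (rule inj_onI, intro ext)
    fix \<pi> \<pi>' x y
    assume pi: "\<pi> \<in> CSTCPP a" "\<pi>' \<in> CSTCPP a" and eq: "pp_lozenge a \<pi> = pp_lozenge a \<pi>'"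
    obtain g where g: "height a (pp_lozenge a \<pi>) g"
      "\<And>x y z. x \<in> {1..int a} \<Longrightarrow> y \<in> {1..int a} \<Longrightarrow> z \<in> {1..int a} \<Longrightarrow>
       z \<le> int (\<pi> (nat x) (nat y)) \<longleftrightarrow> g x y z \<le> 0" using CSTCPP_imp_height[OF pi(1)] by blast
    obtain g' where g': "height a (pp_lozenge a \<pi>') g'"
      "\<And>x y z. x \<in> {1..int a} \<Longrightarrow> y \<in> {1..int a} \<Longrightarrow> z \<in> {1..int a} \<Longrightarrow>
       z \<le> int (\<pi>' (nat x) (nat y)) \<longleftrightarrow> g' x y z \<le> 0" using CSTCPP_imp_height[OF pi(2)] by blast
    show "\<pi> x y = \<pi>' x y"
    proof (cases "x \<in> {1..a} \<and> y \<in> {1..a}")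
      case False
      then show ?thesis using pi by (simp add: CSTCPP_def plane_partition_def)
    next
      case True
      have *: "z \<le> \<pi> x y \<longleftrightarrow> z \<le> \<pi>' x y" if z: "z \<in> {1..a}" for z
      proof -
        have "hexpt a x y z" using True z by (auto simp: hexpt_def)
        then have "g x y z = g' x y z"
          using height_unique[OF g(1)] g'(1) eq by simp
        then show ?thesis using g(2)[of x y z] g'(2)[of x y z] True z by auto
      qed
      show ?thesis
        using *[of "\<pi> x y"] *[of "\<pi>' x y"] le[OF pi(1), of x y] le[OF pi(2), of x y]
        by (cases "\<pi> x y = 0"; cases "\<pi>' x y = 0") auto
    qed
  qed
  show "pp_lozenge a ` CSTCPP a = {C. sym_matching a C}"
  proof (intro subset_antisym subsetI)
    fix C assume "C \<in> pp_lozenge a ` CSTCPP a"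
    then obtain \<pi> where pi: "\<pi> \<in> CSTCPP a" and C: "C = pp_lozenge a \<pi>" by blast
    obtain g where "height a (pp_lozenge a \<pi>) g" by (rule CSTCPP_imp_height[OF pi]) (rule that)
    then show "C \<in> {C. sym_matching a C}"
      using height_imp_sym_matching pp_lozenge_bounds le[OF pi] C by simp
  next
    fix C assume "C \<in> {C. sym_matching a C}"
    then have C: "sym_matching a C" by simp
    then obtain g where g: "height a C g" using sym_matching_imp_height a by fastforce
    obtain \<pi> where pi: "\<pi> \<in> CSTCPP a"
      "\<And>x y z. x \<in> {1..int a} \<Longrightarrow> y \<in> {1..int a} \<Longrightarrow> z \<in> {1..int a} \<Longrightarrow>
         z \<le> int (\<pi> (nat x) (nat y)) \<longleftrightarrow> g x y z \<le> 0"
      using height_imp_CSTCPP[OF g] by blast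
    have "pp_lozenge a \<pi> = C"
    proof (rule height_imp_pp_lozenge[OF g])
      show "i + j + k = 3 * int a - 2 \<and> i \<in> {0..<2*int a} \<and> j \<in> {0..<2*int a} \<and> k \<in> {0..<2*int a-1}"
        if "C i j k" for i j k using C that unfolding sym_matching_def by blast
    qed (use pi le in auto)
    then show "C \<in> pp_lozenge a ` CSTCPP a" using pi by blast
  qed
qed

section \<open>Symmetric matchings of the hexagon\<close>

fun sort3 :: "nat \<times> nat \<times> nat \<Rightarrow> nat \<times> nat \<times> nat" where
  "sort3 (i,j,k) = (max i (max j k), (i + j + k) - max i (max j k) - min i (min j k), min i (min j k))"

text \<open>Edges between symmetric triangles are forced; all other edges are transported from the
  fundamental domain by sorting.\<close>

definition symmetrize :: "nat \<Rightarrow> (nat \<times> nat \<times> nat \<Rightarrow> nat \<times> nat \<times> nat) \<Rightarrow> int \<Rightarrow> int \<Rightarrow> int \<Rightarrow> bool" where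
  "symmetrize a f i j k \<longleftrightarrow> 0 \<le> i \<and> 0 \<le> j \<and> 0 \<le> k \<and> i < 2 * int a \<and> j < 2 * int a \<and> k < 2 * int a - 1 \<and>
     i + j + k = 3 * int a - 2 \<and>
     (i = j \<or> i \<noteq> k \<and> j \<noteq> k \<and> f (sort3 (nat i, nat j, nat k)) = sort3 (nat i, nat j, nat (k+1)))"

lemma sort3_eq:
  assumes "k \<le> j" "j \<le> i"
  shows "sort3 (i,j,k) = (i,j,k)" "sort3 (j,k,i) = (i,j,k)" "sort3 (i,k,j) = (i,j,k)"
proof -
  have m: "max j k = j" "max k j = j" "max i j = i" "max k i = i" "max j i = i"
    "min j k = k" "min k j = k" "min i k = k" "min k i = k"
    using assms by auto
  show "sort3 (i,j,k) = (i,j,k)" "sort3 (j,k,i) = (i,j,k)" "sort3 (i,k,j) = (i,j,k)"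
    by (simp_all add: m)
qed

lemma symmetrize_comm: "symmetrize a f i j k \<longleftrightarrow> symmetrize a f j i k"
  by (auto simp: symmetrize_def max.left_commute min.left_commute add.commute)

lemma symmetrize_diag: "symmetrize a f i i k \<longleftrightarrow> 0 \<le> i \<and> 0 \<le> k \<and> i < 2 * int a \<and> k < 2 * int a - 1 \<and> 2*i + k = 3 * int a - 2"
  by (auto simp: symmetrize_def)

lemma symmetrize_off_diag: "symmetrize a f i k i \<longleftrightarrow> False" "symmetrize a f k i i \<longleftrightarrow> False"
  if "0 < a" "i \<noteq> k"
  using that by (auto simp: symmetrize_def)

context
  fixes a :: nat and f
  assumes f: "f \<in> matchings a"
begin

lemma symmetrize_sorted:
  fixes i j k :: int
  assumes "0 \<le> k" "k < j" "j < i" "i < 2 * int a" "i + j + k = 3 * int a - 2"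
  shows "symmetrize a f j k i \<longleftrightarrow> f (nat i, nat j, nat k) = (Suc (nat i), nat j, nat k)"
    "symmetrize a f i k j \<longleftrightarrow> f (nat i, nat j, nat k) = (nat i, Suc (nat j), nat k)"
    "symmetrize a f i j k \<longleftrightarrow> f (nat i, nat j, nat k) = (nat i, nat j, Suc (nat k))"
proof -
  have mem: "(nat i, nat j, nat k) \<in> strict_triples a (3*a-2)"
    using assms by (auto simp: strict_triples_def)
  have s: "sort3 (nat j, nat k, nat i) = (nat i, nat j, nat k)" "sort3 (nat i, nat k, nat j) = (nat i, nat j, nat k)"
     "sort3 (nat i, nat j, nat k) = (nat i, nat j, nat k)"
     "sort3 (nat j, nat k, nat (i+1)) = (Suc (nat i), nat j, nat k)"
     "sort3 (nat i, nat k, nat (j+1)) = (nat i, Suc (nat j), nat k)"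
     "sort3 (nat i, nat j, nat (k+1)) = (nat i, nat j, Suc (nat k))"
  proof -
    have e: "nat (i+1) = Suc (nat i)" "nat (j+1) = Suc (nat j)" "nat (k+1) = Suc (nat k)"
      using assms by auto
    have lt: "nat k \<le> nat j" "nat j \<le> nat i" "nat j \<le> Suc (nat i)" "nat k \<le> Suc (nat j)"
      "Suc (nat j) \<le> nat i" "Suc (nat k) \<le> nat j" using assms by auto
    show "sort3 (nat j, nat k, nat i) = (nat i, nat j, nat k)"
      "sort3 (nat i, nat k, nat j) = (nat i, nat j, nat k)"
      "sort3 (nat i, nat j, nat k) = (nat i, nat j, nat k)"
      "sort3 (nat j, nat k, nat (i+1)) = (Suc (nat i), nat j, nat k)"
      "sort3 (nat i, nat k, nat (j+1)) = (nat i, Suc (nat j), nat k)"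
      "sort3 (nat i, nat j, nat (k+1)) = (nat i, nat j, Suc (nat k))"
      unfolding e
      using sort3_eq[OF lt(1,2)] sort3_eq[OF lt(1,3)] sort3_eq[OF lt(4,5)] sort3_eq[OF lt(6,2)]
      by blast+
  qed
  have "i < 2 * int a - 1" if "f (nat i, nat j, nat k) = (Suc (nat i), nat j, nat k)"
    using matching_mem[OF f mem] that assms by (auto simp: strict_triples_def)
  then show "symmetrize a f j k i \<longleftrightarrow> f (nat i, nat j, nat k) = (Suc (nat i), nat j, nat k)"
    unfolding symmetrize_def s using assms by auto
  show "symmetrize a f i k j \<longleftrightarrow> f (nat i, nat j, nat k) = (nat i, Suc (nat j), nat k)"
    "symmetrize a f i j k \<longleftrightarrow> f (nat i, nat j, nat k) = (nat i, nat j, Suc (nat k))"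
    unfolding symmetrize_def s using assms by auto
qed

lemma symmetrize_sorted_nat:
  assumes "k < j" "j < i" "i < 2*a" "i + j + k + 2 = 3*a"
  shows "symmetrize a f (int j) (int k) (int i) \<longleftrightarrow> f (i,j,k) = (Suc i,j,k)"
    "symmetrize a f (int i) (int k) (int j) \<longleftrightarrow> f (i,j,k) = (i,Suc j,k)"
    "symmetrize a f (int i) (int j) (int k) \<longleftrightarrow> f (i,j,k) = (i,j,Suc k)"
proof -
  have "0 \<le> int k" "int k < int j" "int j < int i" "int i < 2 * int a" "int i + int j + int k = 3 * int a - 2"
    using assms by linarith+
  note r = symmetrize_sorted[OF this, unfolded nat_int]
  from r show "symmetrize a f (int j) (int k) (int i) \<longleftrightarrow> f (i,j,k) = (Suc i,j,k)"
    "symmetrize a f (int i) (int k) (int j) \<longleftrightarrow> f (i,j,k) = (i,Suc j,k)"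
    "symmetrize a f (int i) (int j) (int k) \<longleftrightarrow> f (i,j,k) = (i,j,Suc k)" .
qed

text \<open>Away from the axes the conditions at a triangle are those of \<open>f\<close> at its
  sorted representative. On an axis the two mirror edges are absent, so the axis edge has to
  exist.\<close>

lemma sym_matching_symmetrize:
  assumes even: "even a" and pos: "0 < a"
  shows "sym_matching a (symmetrize a f)"
proof -
  let ?C = "symmetrize a f"
  let ?A = "int a"
  have inj: "u = u'" if "f u = f u'" "u \<in> strict_triples a (3*a-2)" "u' \<in> strict_triples a (3*a-2)" for u u'
    using f that by (auto simp: matchings_def bij_betw_def inj_on_def)
  \<comment> \<open>These equations describe the triangles \<open>(2*a-1,j,j)\<close> of degree
    \<open>3*a-2\<close> and \<open>(j,j,0)\<close> of degree \<open>3*a-1\<close>, whose axis edges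
    would leave the hexagon.\<close>
  have odd: "2 * j \<noteq> ?A - 1" "2 * j \<noteq> 3 * ?A - 1" for j
    using even by presburger+
  have Xs: "of_bool (?C j k i) + of_bool (?C i k j) + of_bool (?C i j k) = (1::int)"
    if r: "0 \<le> k" "k \<le> j" "j \<le> i" "i < 2*?A" "i + j + k = 3*?A - 2" for i j k
  proof -
    consider "k < j" "j < i" | "i = j" "k < j" | "k = j" "j < i" | "i = j" "k = j" using r by linarith
    then show ?thesis
    proof cases
      case 1
      then have "(nat i, nat j, nat k) \<in> strict_triples a (3*a-2)"
        using r by (auto simp: strict_triples_def)
      from matching_step[OF f this] show ?thesis
        using symmetrize_sorted[of k j i] 1 r by auto
    next
      case 2
      then show ?thesis using r pos by (simp add: symmetrize_diag symmetrize_off_diag)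
    next
      case 3
      then show ?thesis using r pos odd(1)[of j] by (simp add: symmetrize_diag symmetrize_off_diag)
    next
      case 4
      then show ?thesis using r by presburger
    qed
  qed
  have Ys: "of_bool (?C j k (i-1)) + of_bool (?C i k (j-1)) + of_bool (?C i j (k-1)) = (1::int)"
    if r: "0 \<le> k" "k \<le> j" "j \<le> i" "i < 2*?A" "i + j + k = 3*?A - 1" for i j k
  proof -
    consider "k < j" "j < i" | "i = j" "k < j" | "k = j" "j < i" | "i = j" "k = j" using r by linarith
    then show ?thesis
    proof cases
      case 1
      obtain I J K where ijk: "i = int I" "j = int J" "k = int K"
        using r 1 by (metis nonneg_int_cases order.trans)
      have rN: "K < J" "J < I" "I < 2*a" "I + J + K + 1 = 3*a" using r 1 unfolding ijk by linarith+
      obtain I' J' where IJ: "I = Suc I'" "J = Suc J'" using rN by (metis gr0_implies_Suc less_zeroE linorder_neqE_nat)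
      define v where "v = (I, J, K)"
      have v: "v \<in> strict_triples a (3*a-1)" using rN by (auto simp: strict_triples_def v_def)
      define u1 u2 u3 where "u1 = (I', J, K)" and "u2 = (I, J', K)" and "u3 = (I, J, K - 1)"
      let ?X = "strict_triples a (3*a-2)"
      have m: "i - 1 = int I'" "j - 1 = int J'" using IJ ijk by auto
      have c1: "?C j k (i-1) \<longleftrightarrow> u1 \<in> ?X \<and> f u1 = v"
      proof (cases "I' = J")
        case True
        then show ?thesis using rN(1) pos symmetrize_off_diag[of a "int J" "int K" f]
          unfolding m ijk(2,3) by (simp add: u1_def strict_triples_def)
      next
        case False
        then have "u1 \<in> ?X" using rN IJ by (auto simp: u1_def strict_triples_def)
        moreover have "?C (int J) (int K) (int I') \<longleftrightarrow> f (I', J, K) = (Suc I', J, K)"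
          by (rule symmetrize_sorted_nat) (use rN IJ False in linarith)+
        ultimately show ?thesis unfolding m ijk(2,3) u1_def v_def IJ(1) by simp
      qed
      have c2: "?C i k (j-1) \<longleftrightarrow> u2 \<in> ?X \<and> f u2 = v"
      proof (cases "J' = K")
        case True
        then show ?thesis using rN(1,2) pos symmetrize_off_diag[of a "int K" "int I" f]
          unfolding m ijk(1,3) by (simp add: u2_def strict_triples_def)
      next
        case False
        then have "u2 \<in> ?X" using rN IJ by (auto simp: u2_def strict_triples_def)
        moreover have "?C (int I) (int K) (int J') \<longleftrightarrow> f (I, J', K) = (I, Suc J', K)"
          by (rule symmetrize_sorted_nat) (use rN IJ False in linarith)+
        ultimately show ?thesis unfolding m ijk(1,3) u2_def v_def IJ(2) by simp
      qed
      have c3: "?C i j (k-1) \<longleftrightarrow> u3 \<in> ?X \<and> f u3 = v"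
      proof (cases K)
        case 0
        then show ?thesis using rN ijk by (auto simp: u3_def strict_triples_def symmetrize_def)
      next
        case (Suc K')
        have mk: "k - 1 = int K'" using Suc ijk by simp
        have "u3 \<in> ?X" using Suc rN by (auto simp: u3_def strict_triples_def)
        moreover have "?C (int I) (int J) (int K') \<longleftrightarrow> f (I, J, K') = (I, J, Suc K')"
          by (rule symmetrize_sorted_nat) (use rN Suc in linarith)+
        ultimately show ?thesis unfolding mk ijk(1,2) u3_def v_def Suc by simp
      qed
      have "v \<in> f ` ?X" using f v by (auto simp: matchings_def bij_betw_def)
      then obtain u where u: "u \<in> ?X" "f u = v" by blast
      have "u = u1 \<or> u = u2 \<or> u = u3"
        using f u unfolding matchings_def unit_step_def u1_def u2_def u3_def v_def IJ by (cases u) fastforce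
      moreover have "u1 \<noteq> u2" "u1 \<noteq> u3" "u2 \<noteq> u3" using rN IJ by (auto simp: u1_def u2_def u3_def)
      moreover have "u1 \<in> ?X \<and> f u1 = v \<longleftrightarrow> u = u1" "u2 \<in> ?X \<and> f u2 = v \<longleftrightarrow> u = u2"
        "u3 \<in> ?X \<and> f u3 = v \<longleftrightarrow> u = u3" using u inj by blast+
      ultimately show ?thesis unfolding c1 c2 c3 by auto
    next
      case 2
      \<comment> \<open>Unless it lies on another axis, \<open>(i,i-1,k)\<close> is strict, and
        \<open>f\<close> takes strict values, so it cannot be matched to the axis triangle
        \<open>(i,i,k)\<close>.\<close>
      have "\<not> ?C i k (i-1)"
      proof (cases "i - 1 = k")
        case True
        then show ?thesis using 2 pos symmetrize_off_diag[of a k i f] by auto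
      next
        case False
        have "(nat i, nat (i-1), nat k) \<in> strict_triples a (3*a-2)"
          using 2 False r by (auto simp: strict_triples_def)
        moreover have "(nat i, Suc (nat (i-1)), nat k) \<notin> strict_triples a (3*a-1)"
          using 2 r by (auto simp: strict_triples_def)
        ultimately show ?thesis
          using symmetrize_sorted(2)[of k "i-1" i] matching_mem[OF f] 2 False r by fastforce
      qed
      moreover have "?C i i (k-1)" using 2 r odd(2)[of i] by (cases "k = 0") (auto simp: symmetrize_diag)
      ultimately show ?thesis using 2 symmetrize_comm[of a f i k] by simp
    next
      case 3
      have "\<not> ?C i j (j-1)"
      proof (cases "j = 0")
        case True
        then show ?thesis by (simp add: symmetrize_def)
      next
        case False
        have "(nat i, nat j, nat (j-1)) \<in> strict_triples a (3*a-2)"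
          using 3 False r by (auto simp: strict_triples_def)
        moreover have "(nat i, nat j, Suc (nat (j-1))) \<notin> strict_triples a (3*a-1)"
          using 3 r False by (auto simp: strict_triples_def)
        ultimately show ?thesis
          using symmetrize_sorted(3)[of "j-1" j i] matching_mem[OF f] 3 False r by fastforce
      qed
      moreover have "?C j j (i-1)" using 3 r by (auto simp: symmetrize_diag)
      ultimately show ?thesis using 3 by simp
    next
      case 4
      then show ?thesis using r by presburger
    qed
  qed
  note comm = symmetrize_comm[of a f]
  have X: "of_bool (?C j k i) + of_bool (?C i k j) + of_bool (?C i j k) = (1::int)"
    if "i \<in> {0..<2*?A}" "j \<in> {0..<2*?A}" "k \<in> {0..<2*?A}" "i + j + k = 3*?A - 2" for i j k
  proof -
    consider "k \<le> j" "j \<le> i" | "k \<le> i" "i \<le> j" | "j \<le> k" "k \<le> i" | "j \<le> i" "i \<le> k" | "i \<le> j" "j \<le> k" | "i \<le> k" "k \<le> j"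
      by linarith
    then show ?thesis
    proof cases
      case 1 with that Xs[of k j i] show ?thesis by simp
    next
      case 2 with that Xs[of k i j] comm[of i j k] show ?thesis by simp
    next
      case 3 with that Xs[of j k i] comm[of j k i] show ?thesis by simp
    next
      case 4 with that Xs[of j i k] comm[of j k i] comm[of i k j] show ?thesis by simp
    next
      case 5 with that Xs[of i j k] comm[of j k i] comm[of i k j] comm[of i j k] show ?thesis by simp
    next
      case 6 with that Xs[of i k j] comm[of i k j] comm[of i j k] show ?thesis by simp
    qed
  qed
  have Y: "of_bool (?C j k (i-1)) + of_bool (?C i k (j-1)) + of_bool (?C i j (k-1)) = (1::int)"
    if "i \<in> {0..<2*?A}" "j \<in> {0..<2*?A}" "k \<in> {0..<2*?A}" "i + j + k = 3*?A - 1" for i j k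
  proof -
    consider "k \<le> j" "j \<le> i" | "k \<le> i" "i \<le> j" | "j \<le> k" "k \<le> i" | "j \<le> i" "i \<le> k" | "i \<le> j" "j \<le> k" | "i \<le> k" "k \<le> j"
      by linarith
    then show ?thesis
    proof cases
      case 1 with that Ys[of k j i] show ?thesis by simp
    next
      case 2 with that Ys[of k i j] comm[of i j "k-1"] show ?thesis by simp
    next
      case 3 with that Ys[of j k i] comm[of j k "i-1"] show ?thesis by simp
    next
      case 4 with that Ys[of j i k] comm[of j k "i-1"] comm[of i k "j-1"] show ?thesis by simp
    next
      case 5 with that Ys[of i j k] comm[of j k "i-1"] comm[of i k "j-1"] comm[of i j "k-1"] show ?thesis by simp
    next
      case 6 with that Ys[of i k j] comm[of i k "j-1"] comm[of i j "k-1"] show ?thesis by simp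
    qed
  qed
  have supp: "i + j + k = 3*?A - 2 \<and> i \<in> {0..<2*?A} \<and> j \<in> {0..<2*?A} \<and> k \<in> {0..<2*?A-1}" if "?C i j k" for i j k
    using that unfolding symmetrize_def by auto
  have comm': "?C j i k" if "?C i j k" for i j k using that comm by blast
  show ?thesis unfolding sym_matching_def using supp comm' X Y by blast
qed

end

lemma inj_on_symmetrize:
  assumes "0 < a"
  shows "inj_on (symmetrize a) (matchings a)"
proof (rule inj_onI)
  fix f f' assume f: "f \<in> matchings a" "f' \<in> matchings a" and eq: "symmetrize a f = symmetrize a f'"
  show "f = f'"
  proof (rule extensionalityI)
    show "f \<in> extensional (strict_triples a (3*a-2))" "f' \<in> extensional (strict_triples a (3*a-2))"
      using f by (auto simp: matchings_def)
    fix u assume u: "u \<in> strict_triples a (3*a-2)"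
    obtain i j k where [simp]: "u = (i,j,k)" by (cases u)
    have r: "0 \<le> int k" "int k < int j" "int j < int i" "int i < 2 * int a" "int i + int j + int k = 3 * int a - 2"
      using u assms by (auto simp: strict_triples_def)
    show "f u = f' u"
      using matching_step[OF f(1), of i j k] u symmetrize_sorted[OF f(1) r] symmetrize_sorted[OF f(2) r] eq by auto
  qed
qed

text \<open>Restrict \<open>C\<close> to the fundamental domain. Axis triangles are matched along
  their axes, so no edge of a strict triangle ends on an axis and \<open>f\<close> stays in the
  domain. Injectivity follows from the conditions at triangles of degree \<open>3*a-1\<close>,
  surjectivity from equal cardinalities.\<close>

lemma symmetrize_surj:
  assumes M: "sym_matching a C" and pos: "0 < a"
  shows "\<exists>f\<in>matchings a. symmetrize a f = C"
proof -
  let ?A = "int a"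
  let ?X = "strict_triples a (3*a-2)" and ?Y = "strict_triples a (3*a-1)"
  have supp: "i + j + k = 3*?A - 2 \<and> i \<in> {0..<2*?A} \<and> j \<in> {0..<2*?A} \<and> k \<in> {0..<2*?A-1}" if "C i j k" for i j k
    using M that unfolding sym_matching_def by blast
  have comm: "C i j k \<longleftrightarrow> C j i k" for i j k
    using M unfolding sym_matching_def by blast
  have X: "of_bool (C j k i) + of_bool (C i k j) + of_bool (C i j k) = (1::int)"
    if "i \<in> {0..<2*?A}" "j \<in> {0..<2*?A}" "k \<in> {0..<2*?A}" "i + j + k = 3*?A - 2" for i j k
    using M that unfolding sym_matching_def by blast
  have Y: "of_bool (C j k (i-1)) + of_bool (C i k (j-1)) + of_bool (C i j (k-1)) = (1::int)"
    if "i \<in> {0..<2*?A}" "j \<in> {0..<2*?A}" "k \<in> {0..<2*?A}" "i + j + k = 3*?A - 1" for i j k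
    using M that unfolding sym_matching_def by blast
  \<comment> \<open>By \<open>comm\<close> the two mirror edges contribute the same value, hence 0
    or 2; a total of 1 leaves only the axis edge.\<close>
  have axis: "C i i k" "\<not> C i k i" "\<not> C k i i"
    if "0 \<le> i" "0 \<le> k" "i < 2*?A" "k < 2*?A" "2*i + k = 3*?A - 2" for i k
    using X[of i i k] that comm[of i k i] by (auto simp: of_bool_def split: if_splits)
  have axisY: "\<not> C i k (i-1)" "\<not> C k i (i-1)"
    if "0 \<le> i" "0 \<le> k" "i < 2*?A" "k < 2*?A" "2*i + k = 3*?A - 1" for i k
    using Y[of i i k] that comm[of i k "i-1"] by (auto simp: of_bool_def split: if_splits)
  define f where "f = restrict (\<lambda>(i,j,k). if C (int j) (int k) (int i) then (Suc i,j,k)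
     else if C (int i) (int k) (int j) then (i,Suc j,k) else (i,j,Suc k)) ?X"
  have r: "k < j" "j < i" "int i \<in> {0..<2*?A}" "int j \<in> {0..<2*?A}" "int k \<in> {0..<2*?A}" "int i + int j + int k = 3*?A - 2"
    if "(i,j,k) \<in> ?X" for i j k
    using that pos by (auto simp: strict_triples_def)
  have f1: "f (i,j,k) = (Suc i,j,k) \<longleftrightarrow> C (int j) (int k) (int i)"
   and f2: "f (i,j,k) = (i,Suc j,k) \<longleftrightarrow> C (int i) (int k) (int j)"
   and f3: "f (i,j,k) = (i,j,Suc k) \<longleftrightarrow> C (int i) (int j) (int k)"
   and fstep: "f (i,j,k) = (Suc i,j,k) \<or> f (i,j,k) = (i,Suc j,k) \<or> f (i,j,k) = (i,j,Suc k)"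
    if u: "(i,j,k) \<in> ?X" for i j k
    using X[OF r(3-6)[OF u]] u by (auto simp: f_def of_bool_def split: if_splits)
  have fY: "f u \<in> ?Y" if u: "u \<in> ?X" for u
  proof -
    obtain i j k where [simp]: "u = (i,j,k)" by (cases u)
    note u' = u[simplified]
    note rr = r[OF u']
    have rN: "k < j" "j < i" "i < 2*a" "i + j + k + 2 = 3*a"
      using u' pos by (auto simp: strict_triples_def)
    show ?thesis using fstep[OF u']
    proof (elim disjE)
      assume e: "f (i,j,k) = (Suc i,j,k)"
      then have "C (int j) (int k) (int i)" using f1[OF u'] by simp
      from supp[OF this] have "Suc i < 2*a" by auto
      then show ?thesis using e rN by (auto simp: strict_triples_def)
    next
      assume e: "f (i,j,k) = (i,Suc j,k)"
      then have c: "C (int i) (int k) (int j)" using f2[OF u'] by simp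
      have "Suc j \<noteq> i"
      proof
        assume "Suc j = i"
        then have "int j = int i - 1" by simp
        then show False using c axisY(1)[of "int i" "int k"] rr by auto
      qed
      then show ?thesis using e rN by (auto simp: strict_triples_def)
    next
      assume e: "f (i,j,k) = (i,j,Suc k)"
      then have c: "C (int i) (int j) (int k)" using f3[OF u'] by simp
      have "Suc k \<noteq> j"
      proof
        assume "Suc k = j"
        then have "int k = int j - 1" by simp
        then show False using c axisY(2)[of "int j" "int i"] rr by auto
      qed
      then show ?thesis using e rN by (auto simp: strict_triples_def)
    qed
  qed
  have inj: "inj_on f ?X"
  proof (rule inj_onI)
    fix u u' assume u: "u \<in> ?X" "u' \<in> ?X" and eq: "f u = f u'"
    obtain i j k where v: "f u = (i,j,k)" by (cases "f u")
    have vY: "(i,j,k) \<in> ?Y" using fY[OF u(1)] v by simp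
    have rr: "int i \<in> {0..<2*?A}" "int j \<in> {0..<2*?A}" "int k \<in> {0..<2*?A}" "int i + int j + int k = 3*?A - 1"
      using vY pos by (auto simp: strict_triples_def)
    have *: "C (int j) (int k) (int i - 1) \<and> u = (i-1,j,k) \<and> 0 < i \<or> C (int i) (int k) (int j - 1) \<and> u = (i,j-1,k) \<and> 0 < j \<or>
        C (int i) (int j) (int k - 1) \<and> u = (i,j,k-1) \<and> 0 < k" if u: "u \<in> ?X" and v: "f u = (i,j,k)" for u
    proof -
      obtain i' j' k' where [simp]: "u = (i',j',k')" by (cases u)
      note u' = u[simplified]
      show ?thesis using fstep[OF u']
      proof (elim disjE)
        assume e: "f (i',j',k') = (Suc i',j',k')"
        then have "i = Suc i'" "j = j'" "k = k'" using v by simp_all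
        moreover have "C (int j') (int k') (int i')" using e f1[OF u'] by blast
        ultimately show ?thesis by simp
      next
        assume e: "f (i',j',k') = (i',Suc j',k')"
        then have "i = i'" "j = Suc j'" "k = k'" using v by simp_all
        moreover have "C (int i') (int k') (int j')" using e f2[OF u'] by blast
        ultimately show ?thesis by simp
      next
        assume e: "f (i',j',k') = (i',j',Suc k')"
        then have "i = i'" "j = j'" "k = Suc k'" using v by simp_all
        moreover have "C (int i') (int j') (int k')" using e f3[OF u'] by blast
        ultimately show ?thesis by simp
      qed
    qed
    have v': "f u' = (i,j,k)" using v eq by simp
    have excl: "\<not> (C (int j) (int k) (int i - 1) \<and> C (int i) (int k) (int j - 1))"
      "\<not> (C (int j) (int k) (int i - 1) \<and> C (int i) (int j) (int k - 1))"
      "\<not> (C (int i) (int k) (int j - 1) \<and> C (int i) (int j) (int k - 1))"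
      using Y[OF rr] by (auto simp: of_bool_def split: if_splits)
    show "u = u'"
      using *[OF u(1) v] *[OF u(2) v'] excl by blast
  qed
  have "bij_betw f ?X ?Y"
  proof -
    have "f ` ?X = ?Y"
      by (rule card_subset_eq) (use fY inj card_strict_triples[OF pos] in \<open>auto simp: card_image\<close>)
    then show ?thesis using inj by (simp add: bij_betw_def)
  qed
  then have fm: "f \<in> matchings a"
    using fstep by (auto simp: matchings_def f_def unit_step_def)
  have "symmetrize a f i j k \<longleftrightarrow> C i j k" if ij: "i \<ge> j" for i j k
  proof (cases "0 \<le> i \<and> 0 \<le> j \<and> 0 \<le> k \<and> i < 2 * ?A \<and> j < 2 * ?A \<and> k < 2 * ?A - 1 \<and> i + j + k = 3 * ?A - 2")
    case False
    then show ?thesis using supp[of i j k] by (auto simp: symmetrize_def)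
  next
    case True
    consider "i = j" | "i \<noteq> j" "i = k" | "i \<noteq> j" "j = k" | "k < j" "j < i" | "j < k" "k < i" | "j < i" "i < k"
      using ij by linarith
    then show ?thesis
    proof cases
      case 1
      then show ?thesis using True axis[of i k] by (simp add: symmetrize_diag)
    next
      case 2
      then show ?thesis using True axis[of k j] pos symmetrize_off_diag[of a i j f] by auto
    next
      case 3
      then show ?thesis using True axis[of k i] pos symmetrize_off_diag[of a j i f] by auto
    next
      case 4
      then have "(nat i, nat j, nat k) \<in> ?X" using True by (auto simp: strict_triples_def)
      from f3[OF this] show ?thesis
        using symmetrize_sorted(3)[OF fm, of k j i] 4 True by simp
    next
      case 5
      then have "(nat i, nat k, nat j) \<in> ?X" using True by (auto simp: strict_triples_def)
      from f2[OF this] show ?thesis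
        using symmetrize_sorted(2)[OF fm, of j k i] 5 True by simp
    next
      case 6
      then have "(nat k, nat i, nat j) \<in> ?X" using True by (auto simp: strict_triples_def)
      from f1[OF this] show ?thesis
        using symmetrize_sorted(1)[OF fm, of j i k] 6 True by simp
    qed
  qed
  then have "symmetrize a f i j k \<longleftrightarrow> C i j k" for i j k
    using comm[of i j k] symmetrize_comm[of a f i j k] by (cases "i \<ge> j") auto
  then have "symmetrize a f = C" by blast
  then show ?thesis using fm by blast
qed

lemma card_matchings_eq_card_sym_matching:
  assumes "even a" "0 < a"
  shows "card (matchings a) = card {C. sym_matching a C}"
  by (rule bij_betw_same_card[of "symmetrize a"])
     (use assms inj_on_symmetrize[of a] sym_matching_symmetrize symmetrize_surj in
       \<open>fastforce simp: bij_betw_def\<close>)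

section \<open>Passage from the monomial bases to arbitrary bases\<close>

theorem theorem5:
  fixes a :: nat
  assumes "even a" and "0 < a"
  shows "U a ` W a (3*a-2) \<subseteq> W a (3*a-1)
    \<and> (\<exists>bb bc. zbasis (W a (3*a-2)) bb \<and> zbasis (W a (3*a-1)) bc)
    \<and> (\<forall>bb bc. zbasis (W a (3*a-2)) bb \<longrightarrow> zbasis (W a (3*a-1)) bc \<longrightarrow>
         length bc = length bb \<and>
         (\<forall>M. M \<in> carrier_mat (length bb) (length bb) \<longrightarrow>
            (\<forall>j<length bb. U a (bb ! j) = zcomb (\<lambda>i. M $$ (i,j)) bc) \<longrightarrow>
            \<bar>det M\<bar> = int (card (CSTCPP a))))"
proof -
  have r: "3*a-1 = Suc (3*a-2)" using assms by simp
  define n where "n = card (strict_triples a (3*a-2))"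
  have n': "n = card (strict_triples a (3*a-1))"
    using card_strict_triples[OF assms(2)] by (simp add: n_def)
  obtain ex where ex: "bij_betw ex {0..<n} (strict_triples a (3*a-2))"
    "\<And>i j. i < n \<Longrightarrow> j < n \<Longrightarrow> before (ex i) (ex j) \<longleftrightarrow> i < j"
    using ordered_enumeration[of a "3*a-2"] unfolding n_def[symmetric] by blast
  obtain ey where ey: "bij_betw ey {0..<n} (strict_triples a (3*a-1))"
    "\<And>i j. i < n \<Longrightarrow> j < n \<Longrightarrow> before (ey i) (ey j) \<longleftrightarrow> i < j"
    using ordered_enumeration[of a "3*a-1"] unfolding n'[symmetric] by blast
  define A :: "int mat" where "A = mat n n (\<lambda>(i,j). of_bool (unit_step (ex j) (ey i)))"
  have A: "A \<in> carrier_mat n n" by (simp add: A_def)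
  have "\<bar>det A\<bar> = int (card (matchings a))"
    by (rule abs_det_adjacency[OF ex ey A]) (simp_all add: A_def)
  then have detA: "\<bar>det A\<bar> = int (card (CSTCPP a))"
    using card_matchings_eq_card_sym_matching[OF assms] card_CSTCPP_eq_card_sym_matching[OF assms(2)]
    by simp
  have "\<bar>det M\<bar> = \<bar>det A\<bar>"
    if bb: "zbasis (W a (3*a-2)) bb" and bc: "zbasis (W a (3*a-1)) bc"
      and M: "M \<in> carrier_mat (length bb) (length bb)"
      and UM: "\<forall>j<length bb. U a (bb ! j) = zcomb (\<lambda>i. M $$ (i,j)) bc" for bb bc M
  proof -
    define P where "P = mat n n (\<lambda>(i,j). (bb ! j) (ex i))"
    define Q where "Q = mat n n (\<lambda>(i,j). (bc ! j) (ey i))"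
    have P: "length bb = n" "\<bar>det P\<bar> = 1"
      using zbasis_evaluation_unimodular[OF ex(1) bb] by (auto simp: P_def)
    have Q: "length bc = n" "\<bar>det Q\<bar> = 1"
      using zbasis_evaluation_unimodular[OF ey(1) bc] by (auto simp: Q_def)
    have carr: "P \<in> carrier_mat n n" "Q \<in> carrier_mat n n" "M \<in> carrier_mat n n"
      using M P by (auto simp: P_def Q_def)
    \<comment> \<open>Both entries are the value of \<open>U a (bb ! j)\<close> at the triple
      \<open>ey i\<close>: on the left through adjacency, on the right through the expansion in
      \<open>bc\<close>. Since \<open>P\<close> and \<open>Q\<close> are unimodular, the
      determinants of \<open>A\<close> and \<open>M\<close> agree up to sign.\<close>
    have "A * P = Q * M"
    proof (rule eq_matI)
      fix i j assume "i < dim_row (Q * M)" "j < dim_col (Q * M)"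
      then have ij: "i < n" "j < n" using carr by auto
      have bbW: "bb ! j \<in> W a (3*a-2)" using bb ij P by (auto simp: zbasis_def)
      have eyi: "ey i \<in> strict_triples a (Suc (3*a-2))" using ey(1) ij r by (auto simp: bij_betw_def)
      have "(A * P) $$ (i,j) = (\<Sum>l\<in>{0..<n}. of_bool (unit_step (ex l) (ey i)) * (bb ! j) (ex l))"
        using ij by (simp add: A_def P_def scalar_prod_def)
      also have "\<dots> = (\<Sum>u\<in>strict_triples a (3*a-2). of_bool (unit_step u (ey i)) * (bb ! j) u)"
        by (rule sum.reindex_bij_betw[OF ex(1)])
      also have "\<dots> = U a (bb ! j) (ey i)" by (rule U_eval[OF bbW eyi, symmetric])
      also have "\<dots> = (\<Sum>l<n. M $$ (l,j) * (bc ! l) (ey i))"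
        using UM ij P Q by (simp add: zcomb_def)
      also have "\<dots> = (Q * M) $$ (i,j)"
        using ij carr(3) by (simp add: Q_def scalar_prod_def atLeast0LessThan mult.commute)
      finally show "(A * P) $$ (i,j) = (Q * M) $$ (i,j)" .
    qed (use A carr in auto)
    then have "det A * det P = det Q * det M"
      using det_mult[OF A carr(1)] det_mult[OF carr(2,3)] by simp
    then have "\<bar>det A\<bar> * \<bar>det P\<bar> = \<bar>det Q\<bar> * \<bar>det M\<bar>" by (simp flip: abs_mult)
    then show ?thesis using P Q by simp
  qed
  moreover have "length bc = length bb"
    if "zbasis (W a (3*a-2)) bb" "zbasis (W a (3*a-1)) bc" for bb bc
    using zbasis_evaluation_unimodular[OF ex(1) that(1)] zbasis_evaluation_unimodular[OF ey(1) that(2)] by simp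
  moreover have "U a ` W a (3*a-2) \<subseteq> W a (3*a-1)" using U_in_W r by auto
  moreover have "\<exists>bb bc. zbasis (W a (3*a-2)) bb \<and> zbasis (W a (3*a-1)) bc"
    using zbasis_antisym_monomials[OF ex(1)] zbasis_antisym_monomials[OF ey(1)] by blast
  ultimately show ?thesis unfolding detA[symmetric] by blast
qed

end
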